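(* There is an absolute constant $C>0$ such that the following holds for every integer $n \geq 1$ and every real $K \geq 1$. Suppose that $A \subseteq \operatorname{U}_n(\mathbb{C})$ is a finite set satisfying $|A^2| \leq K|A|$. Then $A$ is contained in at most $n^{Cn^3}K^{Cn}$ cosets of some connected abelian subgroup $S \subseteq \operatorname{U}_n(\mathbb{C})$.
   Context: $\operatorname{U}_n(\mathbb{C})$ is the group of $n \times n$ complex unitary matrices. $A^2 := \{a_1a_2 : a_1,a_2 \in A\}$. *)

theory Defs
  imports
    "HOL-Analysis.Analysis"
    "HOL-Algebra.Left_Coset"
    "Jordan_Normal_Form.Schur_Decomposition"
begin

text \<open>
  The dimension \<open>n\<close> is quantified inside the statement (after the absolute constant), so
  matrices are taken from the carrier-based type \<open>complex mat\<close> rather than from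
  \<open>complex ^ 'n ^ 'n\<close>.
\<close>

definition unitary_group :: "nat \<Rightarrow> complex mat monoid" where
  "unitary_group n =
     \<lparr>carrier = {M \<in> carrier_mat n n.
        mat_adjoint M * M = 1\<^sub>m n \<and> M * mat_adjoint M = 1\<^sub>m n},
      mult = (*), one = 1\<^sub>m n\<rparr>"

text \<open>
  The type \<open>complex mat\<close> carries no topology in the library. The usual one on the
  \<open>n \<times> n\<close> matrices identifies them with \<open>n\<^sup>2\<close>-tuples of entries. Entries with
  an index out of range are not determined by the matrix type, hence the restriction to
  \<open>{..<n} \<times> {..<n}\<close>.
\<close>

definition mat_topology :: "nat \<Rightarrow> complex mat topology" where
  "mat_topology n =
     pullback_topology (carrier_mat n n)
       (\<lambda>M. restrict (\<lambda>ij. M $$ ij) ({..<n} \<times> {..<n}))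
       (product_topology (\<lambda>_. euclidean) ({..<n} \<times> {..<n}))"

lemma topspace_mat_topology [simp]: "topspace (mat_topology n) = carrier_mat n n"
  by (auto simp: mat_topology_def topspace_pullback_topology)

lemma dim_mat_adjoint [simp]:
  "dim_row (mat_adjoint M) = dim_col M" "dim_col (mat_adjoint M) = dim_row M"
  by (auto simp: mat_adjoint_def)

lemma mat_adjoint_carrier [simp, intro]:
  "M \<in> carrier_mat n m \<Longrightarrow> mat_adjoint M \<in> carrier_mat m n"
  by auto

lemma index_mat_adjoint:
  fixes M :: "complex mat"
  assumes "i < dim_col M" "j < dim_row M"
  shows "mat_adjoint M $$ (i, j) = cnj (M $$ (j, i))"
  using assms by (simp add: mat_adjoint_def mat_of_rows_def)

lemma mat_adjoint_mat_adjoint: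
  fixes M :: "complex mat"
  shows "mat_adjoint (mat_adjoint M) = M"
  by (rule eq_matI) (auto simp: index_mat_adjoint)

lemma mat_adjoint_one: "mat_adjoint (1\<^sub>m n :: complex mat) = 1\<^sub>m n"
  by (rule eq_matI) (auto simp: index_mat_adjoint)

lemma mat_adjoint_mult:
  fixes M N :: "complex mat"
  assumes "M \<in> carrier_mat n m" "N \<in> carrier_mat m k"
  shows "mat_adjoint (M * N) = mat_adjoint N * mat_adjoint M"
proof (rule eq_matI)
  fix i j assume "i < dim_row (mat_adjoint N * mat_adjoint M)"
    and "j < dim_col (mat_adjoint N * mat_adjoint M)"
  with assms have ij: "i < k" "j < n" by auto
  with assms have "mat_adjoint (M * N) $$ (i, j) = cnj (\<Sum>l<m. M $$ (j, l) * N $$ (l, i))"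
    by (simp add: index_mat_adjoint scalar_prod_def atLeast0LessThan)
  also have "\<dots> = (\<Sum>l<m. mat_adjoint N $$ (i, l) * mat_adjoint M $$ (l, j))"
    unfolding cnj_sum
    by (rule sum.cong) (use assms ij in \<open>auto simp: index_mat_adjoint\<close>)
  also have "\<dots> = (mat_adjoint N * mat_adjoint M) $$ (i, j)"
    using assms ij by (simp add: scalar_prod_def atLeast0LessThan)
  finally show "mat_adjoint (M * N) $$ (i, j) = (mat_adjoint N * mat_adjoint M) $$ (i, j)" .
qed (use assms in auto)

lemma group_unitary_group: "group (unitary_group n)"
proof -
  have mult: "mat_adjoint (M * N) * (M * N) = 1\<^sub>m n"
    if M: "M \<in> carrier_mat n n" "mat_adjoint M * M = 1\<^sub>m n"
      and N: "N \<in> carrier_mat n n" "mat_adjoint N * N = 1\<^sub>m n" for M N :: "complex mat"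
  proof -
    have "mat_adjoint (M * N) * (M * N) = mat_adjoint N * mat_adjoint M * (M * N)"
      using mat_adjoint_mult[OF M(1) N(1)] by simp
    also have "\<dots> = mat_adjoint N * (mat_adjoint M * (M * N))"
      using M N by (intro assoc_mult_mat[of _ n n _ n _ n]) auto
    also have "mat_adjoint M * (M * N) = mat_adjoint M * M * N"
      using M N by (intro assoc_mult_mat[symmetric, of _ n n _ n _ n]) auto
    finally show ?thesis using M N by simp
  qed
  have mult': "(M * N) * mat_adjoint (M * N) = 1\<^sub>m n"
    if M: "M \<in> carrier_mat n n" "M * mat_adjoint M = 1\<^sub>m n"
      and N: "N \<in> carrier_mat n n" "N * mat_adjoint N = 1\<^sub>m n" for M N :: "complex mat"
    using mult[of "mat_adjoint N" "mat_adjoint M"] M N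
    by (simp add: mat_adjoint_mat_adjoint flip: mat_adjoint_mult)
  show ?thesis
  proof (rule groupI)
    fix M assume M: "M \<in> carrier (unitary_group n)"
    show "\<exists>N\<in>carrier (unitary_group n).
        N \<otimes>\<^bsub>unitary_group n\<^esub> M = \<one>\<^bsub>unitary_group n\<^esub>"
      by (rule bexI[of _ "mat_adjoint M"])
        (use M in \<open>auto simp: unitary_group_def mat_adjoint_mat_adjoint\<close>)
  qed (auto simp: unitary_group_def mat_adjoint_one mult mult' intro: assoc_mult_mat)
qed

end

theory Submission
  imports Defs
begin

text \<open>
  Petridis' lemma and the Ruzsa calculus give a symmetric set \<open>B\<close> all of whose powers have size
  \<open>K\<^bsup>O(1)\<^esup> |B|\<close>, such that \<open>K\<close> left translates of \<open>B\<close> cover \<open>A\<close>. For a set \<open>\<E>\<close> of orthogonal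
  projections with sum 1, let \<open>H\<close> be the group of unitary matrices commuting with \<open>\<E>\<close>, and \<open>T\<close>
  the torus of matrices acting as a scalar on every block. Suppose that
  \<open>B\<^sup>2 \<inter> H\<close> is a large part of \<open>B\<close>. By pigeonhole many elements of \<open>B\<^sup>4 \<inter> H\<close> are close to 1. If all of
  them lie in \<open>T\<close>, then few cosets of \<open>T\<close> cover \<open>B\<close>. Otherwise take \<open>g\<close> in \<open>(B\<^sup>4 \<inter> H) - T\<close> nearest to 1.
  Its conjugates by elements near 1 are much closer to each other than \<open>g\<close> is to 1, so two of them
  in the same translate of \<open>B\<^sup>2\<close> differ by an element of \<open>T\<close>, which a trace computation shows to
  be 1. Hence \<open>g\<close> has only \<open>K\<^bsup>O(1)\<^esup>\<close> conjugates, and a large part of \<open>B\<close> lies in the centralizer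
  of \<open>g\<close> in \<open>H\<close>. A spectral projection of \<open>g\<close> splits a member of \<open>\<E>\<close>, so there are at most \<open>n\<close> steps.
\<close>

section \<open>Small doubling in groups\<close>

text \<open>Being nearest to 1 concerns elements of \<open>B^4\<close> only, while the conjugates of
  \<open>g\<close> lie in \<open>B^12\<close>. Covering \<open>B^12\<close> by translates of
  \<open>B^2\<close> bridges this gap: the quotient of two conjugates in one translate falls back
  into \<open>B^4\<close>. With radius 1/5 a conjugation moves \<open>g\<close> by at most 2/5 of
  its distance to 1, so such a quotient is nearer to 1 than \<open>g\<close> and cannot lie outside
  \<open>T\<close>. Block traces then decide, because conjugation inside \<open>H\<close> preserves
  them and near 1 they do not vanish. The part of the centralizer obtained this way sits in
  \<open>B^8\<close>; iterating with it would let the exponents grow at every step. Comparing two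
  counts of cosets returns to \<open>B^2\<close>, so each step costs the same factor
  \<open>Q\<close>. In it, \<open>K^216\<close> splits into \<open>K^132\<close> for the conjugates
  and \<open>K^84\<close> for the return, and \<open>(16 n + 1)^(2 n^2)\<close> counts grid cells in
  \<open>2 n^2\<close> real coordinates. The \<open>K\<close> translates raise 216 to 217. The bound
  on the grid needs \<open>n \<ge> 2\<close>; for \<open>n = 1\<close> every power of
  \<open>n\<close> is 1, but the whole group is a torus.\<close>

lemma exists_large_fibre:
  assumes "finite A" "A \<noteq> {}"
  shows "\<exists>y\<in>f ` A. card A \<le> card (f ` A) * card {x \<in> A. f x = y}"
proof (rule ccontr)
  assume "\<not> ?thesis"
  then have small: "card (f ` A) * card {x \<in> A. f x = y} < card A" if "y \<in> f ` A" for y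
    using that by force
  have "card A = (\<Sum>y\<in>f ` A. card {x \<in> A. f x = y})"
    using sum.image_gen[OF assms(1), of "\<lambda>_. 1::nat" f] by simp
  then have "card (f ` A) * card A = (\<Sum>y\<in>f ` A. card (f ` A) * card {x \<in> A. f x = y})"
    by (simp add: sum_distrib_left)
  also have "\<dots> < (\<Sum>y\<in>f ` A. card A)"
    using assms small by (intro sum_strict_mono) auto
  finally show False by simp
qed

primrec set_pow :: "('a, 'b) monoid_scheme \<Rightarrow> 'a set \<Rightarrow> nat \<Rightarrow> 'a set" where
  "set_pow G B 0 = {\<one>\<^bsub>G\<^esub>}"
| "set_pow G B (Suc m) = set_pow G B m <#>\<^bsub>G\<^esub> B"

context group
begin

lemma set_mult_memI: "x \<in> U \<Longrightarrow> y \<in> V \<Longrightarrow> x \<otimes> y \<in> U <#> V"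
  by (auto simp: set_mult_def)

lemma finite_set_mult: "finite U \<Longrightarrow> finite V \<Longrightarrow> finite (U <#> V)"
  by (simp add: set_mult_def)

lemma set_inv_closed: "U \<subseteq> carrier G \<Longrightarrow> set_inv U \<subseteq> carrier G"
  by (auto simp: SET_INV_def)

lemma set_inv_eq_image: "set_inv U = m_inv G ` U"
  by (auto simp: SET_INV_def)

lemma card_set_inv: "U \<subseteq> carrier G \<Longrightarrow> card (set_inv U) = card U"
  unfolding set_inv_eq_image by (rule card_image, rule inj_onI) (metis inv_inv subsetD)

lemma set_inv_set_inv: "U \<subseteq> carrier G \<Longrightarrow> set_inv (set_inv U) = U"
  by (force simp: SET_INV_def)

lemma set_inv_set_mult:
  assumes "U \<subseteq> carrier G" "V \<subseteq> carrier G"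
  shows "set_inv (U <#> V) = set_inv V <#> set_inv U"
proof -
  have "inv (x \<otimes> y) = inv y \<otimes> inv x" if "x \<in> U" "y \<in> V" for x y
    using assms that by (simp add: inv_mult_group subsetD)
  then show ?thesis
    unfolding SET_INV_def set_mult_def by fastforce
qed

lemma card_set_mult_singleton:
  assumes "U \<subseteq> carrier G" "c \<in> carrier G"
  shows "card (U <#> {c}) = card U"
proof -
  have "U <#> {c} = (\<lambda>x. x \<otimes> c) ` U" by (auto simp: set_mult_def)
  moreover have "inj_on (\<lambda>x. x \<otimes> c) U"
    using assms by (auto intro!: inj_onI simp: subset_iff)
  ultimately show ?thesis by (simp add: card_image)
qed

lemma card_le_card_set_mult_right:
  assumes "finite U" "finite V" "U \<subseteq> carrier G" "V \<subseteq> carrier G" "V \<noteq> {}"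
  shows "card U \<le> card (U <#> V)"
proof -
  obtain v where v: "v \<in> V" using assms by auto
  have "card U = card (U <#> {v})" using card_set_mult_singleton assms v by auto
  also have "\<dots> \<le> card (U <#> V)"
    using assms v by (intro card_mono finite_set_mult mono_set_mult) auto
  finally show ?thesis .
qed

text \<open>Fix for every \<open>y \<in> V W\<close> a factorisation \<open>y = v w\<close>; then
  \<open>(u, y) \<mapsto> (v u\<^sup>-\<^sup>1, u w)\<close> is injective, because the product of the two components is \<open>y\<close>.\<close>

lemma ruzsa_triangle:
  assumes "finite U" "finite V" "finite W"
    and "U \<subseteq> carrier G" "V \<subseteq> carrier G" "W \<subseteq> carrier G"
  shows "card U * card (V <#> W) \<le> card (V <#> set_inv U) * card (U <#> W)"
proof -
  have "\<forall>y\<in>V <#> W. \<exists>v w. v \<in> V \<and> w \<in> W \<and> y = v \<otimes> w" by (auto simp: set_mult_def)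
  then obtain v w where vw: "\<And>y. y \<in> V <#> W \<Longrightarrow> v y \<in> V \<and> w y \<in> W \<and> y = v y \<otimes> w y"
    by metis
  let ?f = "\<lambda>(u, y). (v y \<otimes> inv u, u \<otimes> w y)"
  have "inj_on ?f (U \<times> (V <#> W))"
  proof (rule inj_onI, clarsimp)
    fix u y u' y'
    assume u: "u \<in> U" "u' \<in> U" and y: "y \<in> V <#> W" "y' \<in> V <#> W"
      and 1: "v y \<otimes> inv u = v y' \<otimes> inv u'" and 2: "u \<otimes> w y = u' \<otimes> w y'"
    have c: "u \<in> carrier G" "u' \<in> carrier G" "v y \<in> carrier G" "v y' \<in> carrier G"
      "w y \<in> carrier G" "w y' \<in> carrier G"
      using u y vw assms by blast+
    have p: "(a \<otimes> inv b) \<otimes> (b \<otimes> d) = a \<otimes> d"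
      if "a \<in> carrier G" "b \<in> carrier G" "d \<in> carrier G" for a b d
      using that by (metis inv_closed inv_solve_right m_assoc m_closed)
    have "v y \<otimes> w y = v y' \<otimes> w y'"
      using p[of "v y" u "w y"] p[of "v y'" u' "w y'"] c 1 2 by simp
    then have yy: "y = y'" using vw y by metis
    with 1 c have "inv u = inv u'" by simp
    with c have "u = u'" by (metis inv_inv)
    with yy show "u = u' \<and> y = y'" by simp
  qed
  then have "card U * card (V <#> W) = card (?f ` (U \<times> (V <#> W)))"
    by (simp add: card_image card_cartesian_product)
  also have "\<dots> \<le> card ((V <#> set_inv U) \<times> (U <#> W))"
  proof (rule card_mono)
    show "finite ((V <#> set_inv U) \<times> (U <#> W))"
      using assms by (auto intro!: finite_set_mult simp: set_inv_eq_image)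
    show "?f ` (U \<times> (V <#> W)) \<subseteq> (V <#> set_inv U) \<times> (U <#> W)"
      using vw by (auto intro!: set_mult_memI simp: set_inv_eq_image)
  qed
  finally show ?thesis by (simp add: card_cartesian_product)
qed

lemma set_mult_union_right: "U <#> (V \<union> W) = (U <#> V) \<union> (U <#> W)"
  by (auto simp: set_mult_def)

text \<open>\<open>X\<close> minimises \<open>|A X| / |X|\<close> among the nonempty subsets of
  \<open>A\<close>. The set \<open>C\<close> grows by one element \<open>c\<close> at a time: the
  part of \<open>X c\<close> already inside \<open>X C\<close> is \<open>Z c\<close>, and
  \<open>A Z c\<close> adds nothing to \<open>A X C\<close>. Minimality bounds \<open>|A Z|\<close>
  below by \<open>r X\<close> times \<open>|Z|\<close>, so the increment of \<open>|A X C|\<close>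
  is at most \<open>r X\<close> times that of \<open>|X C|\<close>.\<close>

lemma petridis:
  assumes A: "finite A" "A \<subseteq> carrier G" "A \<noteq> {}"
  obtains X where "X \<subseteq> A" "X \<noteq> {}"
    and "\<And>C. finite C \<Longrightarrow> C \<subseteq> carrier G \<Longrightarrow>
      card (A <#> X <#> C) * card A \<le> card (A <#> A) * card (X <#> C)"
proof -
  define r where "r X = real (card (A <#> X)) / real (card X)" for X
  have fin: "finite (Pow A - {{}})" and ne: "Pow A - {{}} \<noteq> {}" using A by auto
  define X where "X = arg_min_on r (Pow A - {{}})"
  have X: "X \<subseteq> A" "X \<noteq> {}"
    using arg_min_if_finite(1)[OF fin ne, of r] by (auto simp: X_def)
  have finX: "finite X" and XG: "X \<subseteq> carrier G" using X A finite_subset by auto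
  have rX: "r X \<le> r Z" if "Z \<subseteq> A" "Z \<noteq> {}" for Z
    using arg_min_least[OF fin ne, of Z r] that by (auto simp: X_def)
  have cX: "card X > 0" using X finX by auto
  have cA: "card A > 0" using A by auto
  have AZ: "r X * card Z \<le> card (A <#> Z)" if "Z \<subseteq> X" for Z
  proof (cases "Z = {}")
    case False
    then have "card Z > 0" using that finX finite_subset card_gt_0_iff by blast
    moreover have "r X \<le> r Z" using that X False by (intro rX) auto
    ultimately show ?thesis by (simp add: r_def field_simps)
  qed auto
  have main: "card (A <#> X <#> C) \<le> r X * card (X <#> C)" if "finite C" "C \<subseteq> carrier G" for C
    using that
  proof (induction C rule: finite_induct)
    case empty
    then show ?case by (simp add: set_mult_def)
  next
    case (insert c C)
    then have c: "c \<in> carrier G" and C: "finite C" "C \<subseteq> carrier G" by auto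
    define Z where "Z = {x \<in> X. x \<otimes> c \<in> X <#> C}"
    have Z: "Z \<subseteq> X" "finite Z" "Z \<subseteq> carrier G" using finX XG by (auto simp: Z_def)
    have e1: "X <#> insert c C = (X <#> C) \<union> ((X - Z) <#> {c})"
      by (auto simp: set_mult_def Z_def)
    have d1: "(X <#> C) \<inter> ((X - Z) <#> {c}) = {}"
      by (auto simp: Z_def) (auto simp: set_mult_def)
    have "card ((X - Z) <#> {c}) = card X - card Z"
      using card_set_mult_singleton[of "X - Z" c] c XG Z finX by (simp add: card_Diff_subset subset_iff)
    then have c1: "card (X <#> insert c C) = card (X <#> C) + (card X - card Z)"
      unfolding e1 using C finX Z by (subst card_Un_disjoint[OF _ _ d1]) (auto intro!: finite_set_mult)
    have ZX: "card Z \<le> card X" using Z finX by (intro card_mono) auto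
    have ZC: "A <#> Z <#> {c} \<subseteq> A <#> X <#> C"
    proof -
      have "Z <#> {c} \<subseteq> X <#> C" by (auto simp: set_mult_def Z_def)
      then have "A <#> (Z <#> {c}) \<subseteq> A <#> (X <#> C)" by (rule mono_set_mult[OF order_refl])
      then show ?thesis using A XG C c Z by (simp add: set_mult_assoc)
    qed
    have sub: "A <#> X <#> insert c C \<subseteq>
        (A <#> X <#> C) \<union> ((A <#> X <#> {c}) - (A <#> Z <#> {c}))"
      using ZC unfolding set_mult_union_right[of _ "{c}" C, simplified] by auto
    have AZX: "A <#> Z <#> {c} \<subseteq> A <#> X <#> {c}"
      using Z by (intro mono_set_mult) auto
    have fAX: "finite (A <#> X)" "A <#> X \<subseteq> carrier G" "finite (A <#> Z)" "A <#> Z \<subseteq> carrier G"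
      using A finX XG Z by (auto intro!: finite_set_mult set_mult_closed del: subsetI)
    have "card (A <#> X <#> insert c C) \<le>
        card (A <#> X <#> C) + card ((A <#> X <#> {c}) - (A <#> Z <#> {c}))"
      by (rule order_trans[OF card_mono[OF _ sub] card_Un_le]) (use fAX C in \<open>auto intro!: finite_set_mult\<close>)
    also have "card ((A <#> X <#> {c}) - (A <#> Z <#> {c})) = card (A <#> X) - card (A <#> Z)"
      using fAX c AZX by (subst card_Diff_subset) (auto simp: card_set_mult_singleton intro!: finite_set_mult)
    finally have "card (A <#> X <#> insert c C) \<le> card (A <#> X <#> C) + (card (A <#> X) - card (A <#> Z))" .
    moreover have "card (A <#> Z) \<le> card (A <#> X)"
      using fAX Z by (intro card_mono mono_set_mult) auto
    ultimately have "real (card (A <#> X <#> insert c C)) \<le>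
        real (card (A <#> X <#> C)) + real (card (A <#> X)) - real (card (A <#> Z))" by linarith
    also have "\<dots> \<le> r X * card (X <#> C) + r X * card X - r X * card Z"
      using insert.IH C AZ[OF Z(1)] cX by (simp add: r_def)
    also have "\<dots> = r X * card (X <#> insert c C)"
      using ZX by (simp add: c1 of_nat_diff algebra_simps)
    finally show ?case .
  qed
  show ?thesis
  proof (rule that[OF X])
    fix C assume C: "finite C" "C \<subseteq> carrier G"
    \<comment> \<open>\<open>A\<close> itself competes in the minimisation, which bounds the minimal
      ratio by the doubling of \<open>A\<close>.\<close>
    have "r X \<le> card (A <#> A) / card A" using rX[of A] A by (simp add: r_def)
    then have "r X * card (X <#> C) \<le> card (A <#> A) / card A * card (X <#> C)"
      by (intro mult_right_mono) auto
    with main[OF C] have "real (card (A <#> X <#> C)) \<le> card (A <#> A) / card A * card (X <#> C)"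
      by linarith
    then have "real (card (A <#> X <#> C) * card A) \<le> real (card (A <#> A) * card (X <#> C))"
      using cA by (simp add: field_simps)
    then show "card (A <#> X <#> C) * card A \<le> card (A <#> A) * card (X <#> C)"
      using of_nat_le_iff by blast
  qed
qed

text \<open>\<open>F\<close> is a largest subset of \<open>V\<close> with pairwise disjoint
  translates \<open>f B\<close>. Disjointness bounds \<open>card F\<close>; maximality makes every
  \<open>v B\<close> meet some \<open>f B\<close>, which puts \<open>v\<close> into
  \<open>f B B^-1\<close>.\<close>

lemma ruzsa_covering:
  assumes "finite V" "finite B" "V \<subseteq> carrier G" "B \<subseteq> carrier G" "B \<noteq> {}"
  obtains F where "F \<subseteq> V" "card F * card B \<le> card (V <#> B)" "V \<subseteq> F <#> (B <#> set_inv B)"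
proof -
  let ?D = "\<lambda>F. F \<subseteq> V \<and> disjoint_family_on (\<lambda>x. l_coset G x B) F"
  have "?D {}" by (auto simp: disjoint_family_on_def)
  then obtain F where F: "?D F" and max: "\<And>F'. ?D F' \<Longrightarrow> card F' \<le> card F"
    using ex_has_greatest_nat[of ?D "{}" card "Suc (card V)"] assms(1) by (auto simp: less_Suc_eq_le dest: card_mono)
  have FG: "F \<subseteq> carrier G" "finite F" using F assms finite_subset by auto
  have "card F * card B = (\<Sum>x\<in>F. card (l_coset G x B))"
  proof -
    have "card (l_coset G x B) = card B" if "x \<in> F" for x
    proof -
      have "inj_on (\<lambda>y. x \<otimes> y) B" using that FG assms by (auto intro!: inj_onI simp: subset_iff)
      moreover have "l_coset G x B = (\<lambda>y. x \<otimes> y) ` B" by (auto simp: l_coset_def)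
      ultimately show ?thesis by (simp add: card_image)
    qed
    then show ?thesis by simp
  qed
  also have "\<dots> = card (\<Union>x\<in>F. l_coset G x B)"
    using F FG assms by (subst card_UN_disjoint') (auto simp: l_coset_def)
  also have "(\<Union>x\<in>F. l_coset G x B) = F <#> B" by (auto simp: l_coset_def set_mult_def)
  also have "card (F <#> B) \<le> card (V <#> B)"
    using F assms by (intro card_mono finite_set_mult mono_set_mult) auto
  finally have "card F * card B \<le> card (V <#> B)" .
  moreover have "V \<subseteq> F <#> (B <#> set_inv B)"
  proof
    fix v assume v: "v \<in> V"
    obtain f b b' where fb: "f \<in> F" "b \<in> B" "b' \<in> B" "f \<otimes> b = v \<otimes> b'"
    proof (cases "v \<in> F")
      case True
      with assms that[of v] show ?thesis by auto
    next
      case False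
      then have "\<not> ?D (insert v F)" using max[of "insert v F"] FG by auto
      then have "\<not> disjoint_family_on (\<lambda>x. l_coset G x B) (insert v F)" using F v by auto
      then obtain f where "f \<in> F" "(l_coset G v B) \<inter> (l_coset G f B) \<noteq> {}"
        using F False by (auto simp: disjoint_family_on_insert)
      then obtain b b' where "b \<in> B" "b' \<in> B" "v \<otimes> b' = f \<otimes> b" by (auto simp: l_coset_def)
      with \<open>f \<in> F\<close> that[of f b b'] show ?thesis by simp
    qed
    have "f \<in> carrier G" "b \<in> carrier G" "b' \<in> carrier G" "v \<in> carrier G" using fb v FG assms by auto
    with fb have "v = f \<otimes> (b \<otimes> inv b')" by (metis inv_solve_right m_assoc inv_closed m_closed)
    with fb show "v \<in> F <#> (B <#> set_inv B)" by (auto simp: set_inv_eq_image intro!: set_mult_memI)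
  qed
  ultimately show ?thesis using that F by blast
qed

section \<open>Powers of a set and their growth\<close>

lemma set_mult_one_right: "U \<subseteq> carrier G \<Longrightarrow> U <#> {\<one>} = U"
  using coset_mult_one[of U] by (simp add: r_coset_eq_set_mult)

lemma set_mult_one_left: "U \<subseteq> carrier G \<Longrightarrow> {\<one>} <#> U = U"
  using lcos_mult_one[of U] by (simp add: l_coset_eq_set_mult)

lemma set_pow_closed: "B \<subseteq> carrier G \<Longrightarrow> set_pow G B m \<subseteq> carrier G"
  by (induction m) (auto intro!: set_mult_closed del: subsetI)

lemma finite_set_pow: "finite B \<Longrightarrow> finite (set_pow G B m)"
  by (induction m) (auto intro: finite_set_mult)

lemma set_pow_add:
  assumes "B \<subseteq> carrier G"
  shows "set_pow G B (a + b) = set_pow G B a <#> set_pow G B b"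
proof (induction b)
  case 0
  then show ?case using set_pow_closed[OF assms, of a] by (simp add: set_mult_one_right)
next
  case (Suc b)
  then show ?case using assms by (simp add: set_mult_assoc set_pow_closed)
qed

lemma set_pow_1: "B \<subseteq> carrier G \<Longrightarrow> set_pow G B 1 = B"
  by (simp add: set_mult_one_left)

lemma set_pow_mult_mem:
  "B \<subseteq> carrier G \<Longrightarrow> x \<in> set_pow G B a \<Longrightarrow> y \<in> set_pow G B b \<Longrightarrow> x \<otimes> y \<in> set_pow G B (a + b)"
  by (simp add: set_pow_add set_mult_memI)

lemma set_inv_set_pow:
  assumes "B \<subseteq> carrier G" "set_inv B = B"
  shows "set_inv (set_pow G B m) = set_pow G B m"
proof (induction m)
  case (Suc m)
  have "set_inv (set_pow G B (Suc m)) = B <#> set_pow G B m"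
    using Suc assms by (simp add: set_inv_set_mult set_pow_closed)
  also have "\<dots> = set_pow G B (1 + m)"
    using set_pow_add[OF assms(1), of 1 m] set_pow_1[OF assms(1)] by simp
  finally show ?case by simp
qed (simp add: SET_INV_def)

lemma set_pow_inv_mem:
  "B \<subseteq> carrier G \<Longrightarrow> set_inv B = B \<Longrightarrow> x \<in> set_pow G B m \<Longrightarrow> inv x \<in> set_pow G B m"
  using set_inv_set_pow[of B m] by (auto simp: set_inv_eq_image)

text \<open>Each further factor costs \<open>L\<close>: the Ruzsa triangle inequality with pivot
  \<open>B\<close>, applied to \<open>B^(m+2)\<close> and \<open>B^2\<close>, bounds
  \<open>|B| |B^(m+4)|\<close> by \<open>|B^(m+3)| |B^3|\<close>, because \<open>B\<close> is its
  own inverse. The induction starts from the third power, as small doubling alone does not control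
  triple products in a noncommutative group.\<close>

lemma card_set_pow_le:
  fixes L :: real
  assumes B: "finite B" "B \<subseteq> carrier G" "set_inv B = B" "B \<noteq> {}"
    and L: "card (set_pow G B 3) \<le> L * card B"
  shows "card (set_pow G B (m + 3)) \<le> L ^ (m + 1) * card B"
proof (induction m)
  case 0
  then show ?case using L by simp
next
  case (Suc m)
  have cB: "0 < card B" using B by auto
  have L0: "0 \<le> L"
  proof (rule ccontr)
    assume "\<not> 0 \<le> L"
    then have "L * card B < 0" using cB by (intro mult_neg_pos) auto
    with L show False by linarith
  qed
  have "card B * card (set_pow G B (Suc m + 3)) \<le> card (set_pow G B (m + 3)) * card (set_pow G B 3)"
  proof -
    have "set_pow G B (Suc m + 3) = set_pow G B (m + 2) <#> set_pow G B 2"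
      by (subst set_pow_add[OF B(2), symmetric]) (rule arg_cong[where f = "set_pow G B"], simp)
    moreover have "set_pow G B (m + 3) = set_pow G B (m + 2) <#> set_inv B"
      using B by (simp add: eval_nat_numeral)
    moreover have "set_pow G B 3 = B <#> set_pow G B 2"
      using set_pow_add[OF B(2), of 1 2] set_pow_1[OF B(2)] by (simp add: eval_nat_numeral)
    ultimately show ?thesis
      using ruzsa_triangle[OF B(1) finite_set_pow[OF B(1)] finite_set_pow[OF B(1)] B(2)
          set_pow_closed[OF B(2)] set_pow_closed[OF B(2)], of "m + 2" 2]
      by (simp only:)
  qed
  then have "real (card B) * card (set_pow G B (Suc m + 3)) \<le> card (set_pow G B (m + 3)) * card (set_pow G B 3)"
    by (metis of_nat_le_iff of_nat_mult)
  also have "\<dots> \<le> (L ^ (m + 1) * card B) * (L * card B)"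
    unfolding of_nat_mult
    using Suc L L0 by (intro mult_mono) auto
  finally show ?case using cB by (simp add: algebra_simps)
qed

text \<open>Small doubling of \<open>A\<close> does not bound \<open>|A^3|\<close>, but for the set
  \<open>X\<close> of \<open>petridis\<close> it gives \<open>|X^3| \<le> K^2 |X|\<close>. With
  \<open>B = X X^-1\<close>, the triangle inequality yields in turn the factors \<open>K^3\<close>
  for \<open>X X X^-1\<close>, \<open>K^6\<close> for \<open>B^2\<close> and \<open>K^12\<close> for
  \<open>B^3\<close>, relative to \<open>|X| \<le> |B|\<close>. The 12 in the growth bound is the
  last of these.\<close>

lemma small_doubling_symmetric_set:
  fixes K :: real
  assumes A: "finite A" "A \<subseteq> carrier G" "A \<noteq> {}" and K: "card (A <#> A) \<le> K * card A" "K \<ge> 1"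
  obtains B F where "finite B" "B \<subseteq> carrier G" "\<one> \<in> B" "set_inv B = B"
    "\<And>m. card (set_pow G B (m + 3)) \<le> K ^ (12 * (m + 1)) * card B"
    "F \<subseteq> carrier G" "finite F" "card F \<le> K" "A \<subseteq> F <#> B"
proof -
  obtain X where X: "X \<subseteq> A" "X \<noteq> {}" and P: "\<And>C. finite C \<Longrightarrow> C \<subseteq> carrier G \<Longrightarrow>
      card (A <#> X <#> C) * card A \<le> card (A <#> A) * card (X <#> C)"
    using petridis[OF A] by blast
  have cA: "0 < card A" using A by auto
  have fX: "finite X" "X \<subseteq> carrier G" using X A finite_subset by auto
  have cX: "0 < card X" using X fX by auto
  have P': "card (A <#> X <#> C) \<le> K * card (X <#> C)" if "finite C" "C \<subseteq> carrier G" for C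
  proof -
    have "real (card (A <#> X <#> C)) * card A \<le> card (A <#> A) * card (X <#> C)"
      using P[OF that] by (metis of_nat_le_iff of_nat_mult)
    also have "\<dots> \<le> (K * card A) * card (X <#> C)" unfolding of_nat_mult using K by (intro mult_right_mono) auto
    finally show ?thesis using cA by simp
  qed
  let ?Y = "set_inv X"
  have Y: "finite ?Y" "?Y \<subseteq> carrier G" "card ?Y = card X" "?Y \<noteq> {}"
    using fX X card_set_inv[OF fX(2)] set_inv_closed[OF fX(2)] by (auto simp: set_inv_eq_image)
  have YY: "set_inv ?Y = X" using fX by (rule_tac set_inv_set_inv)
  define B where "B = X <#> ?Y"
  have B: "finite B" "B \<subseteq> carrier G" "set_inv B = B" "\<one> \<in> B"
  proof -
    show "finite B" "B \<subseteq> carrier G" "set_inv B = B" unfolding B_def using fX Y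
      by (auto intro!: finite_set_mult set_mult_closed simp: set_inv_set_mult YY del: subsetI)
    obtain x where "x \<in> X" using X by auto
    then have "x \<otimes> inv x \<in> B" unfolding B_def by (intro set_mult_memI) (auto simp: set_inv_eq_image)
    then show "\<one> \<in> B" using \<open>x \<in> X\<close> fX by (auto simp: subset_iff)
  qed
  have AX: "card (A <#> X) \<le> K * card X"
  proof -
    show ?thesis using P'[of "{\<one>}"] fX A by (simp add: set_mult_closed set_mult_one_right)
  qed
  have X2: "card (X <#> X) \<le> K * card X"
    using AX card_mono[OF finite_set_mult[of A X] mono_set_mult[of X A X X]] A X fX by force
  have X3: "card (X <#> X <#> X) \<le> K^2 * card X"
  proof -
    have "card (X <#> X <#> X) \<le> card (A <#> X <#> X)"
      using A X fX by (intro card_mono finite_set_mult mono_set_mult) auto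
    also have "real \<dots> \<le> K * card (X <#> X)" using P' fX by auto
    also have "\<dots> \<le> K * (K * card X)" using X2 K by (intro mult_left_mono) auto
    finally show ?thesis by (simp add: power2_eq_square)
  qed
  \<comment> \<open>The Ruzsa triangle inequality with pivot \<open>X\<close>, normalised by
    \<open>|X|\<close>.\<close>
  have tri: "card (V <#> W) \<le> a * b * card X"
    if "finite V" "finite W" "V \<subseteq> carrier G" "W \<subseteq> carrier G"
      "card (V <#> ?Y) \<le> a * card X" "card (X <#> W) \<le> b * card X" "0 \<le> a" for V W and a b :: real
  proof -
    have "card X * card (V <#> W) \<le> card (V <#> ?Y) * card (X <#> W)"
      using ruzsa_triangle[of X V W] that fX by auto
    then have "real (card X) * card (V <#> W) \<le> real (card (V <#> ?Y)) * card (X <#> W)"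
      by (metis of_nat_le_iff of_nat_mult)
    also have "\<dots> \<le> (a * card X) * (b * card X)" using that by (intro mult_mono) auto
    finally show ?thesis using cX by (simp add: field_simps)
  qed
  have XXY: "card (X <#> X <#> ?Y) \<le> K^3 * card X"
  proof -
    \<comment> \<open>The pivot is now \<open>X^-1\<close>, so that the triple product
      \<open>X X X\<close> appears on the right.\<close>
    have "card X * card (X <#> X <#> ?Y) \<le> card (X <#> X <#> X) * card (?Y <#> ?Y)"
      using ruzsa_triangle[of ?Y "X <#> X" ?Y] fX Y by (simp add: YY finite_set_mult set_mult_closed)
    moreover have "card (?Y <#> ?Y) = card (X <#> X)"
      using fX by (metis card_set_inv set_inv_set_mult set_mult_closed)
    ultimately have "real (card X) * card (X <#> X <#> ?Y) \<le> real (card (X <#> X <#> X)) * card (X <#> X)"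
      by (metis of_nat_le_iff of_nat_mult)
    also have "\<dots> \<le> (K^2 * card X) * (K * card X)" using X2 X3 K by (intro mult_mono) auto
    finally show ?thesis using cX by (simp add: field_simps eval_nat_numeral)
  qed
  have XYY: "card (B <#> ?Y) \<le> K^3 * card X"
  proof -
    have "set_inv (B <#> ?Y) = X <#> X <#> ?Y"
      unfolding B_def using fX Y by (simp add: set_inv_set_mult set_mult_closed YY set_mult_assoc)
    then show ?thesis using XXY B Y by (metis card_set_inv set_mult_closed)
  qed
  have XB: "card (X <#> B) \<le> K^3 * card X"
    using XXY fX Y by (simp add: B_def set_mult_assoc)
  have BB: "card (B <#> B) \<le> K^6 * card X"
    using tri[of B B "K^3" "K^3"] B XYY XB K by (simp flip: power_add)
  \<comment> \<open>\<open>B^3\<close> is cut in the middle of its central factor, as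
    \<open>B X\<close> times \<open>X^-1 B\<close>. Completed by \<open>X^-1\<close> and by
    \<open>X\<close> respectively, both halves become \<open>B B\<close>.\<close>
  have "card ((B <#> X) <#> (?Y <#> B)) \<le> K^6 * K^6 * card X"
  proof (rule tri)
    show "card (B <#> X <#> ?Y) \<le> K^6 * card X"
      using BB B fX Y by (simp add: B_def set_mult_assoc set_mult_closed)
    show "card (X <#> (?Y <#> B)) \<le> K^6 * card X"
      using BB B fX Y by (simp add: B_def set_mult_assoc set_mult_closed)
  qed (use B fX Y K in \<open>auto intro!: finite_set_mult set_mult_closed del: subsetI\<close>)
  moreover have "(B <#> X) <#> (?Y <#> B) = set_pow G B 3"
  proof -
    have "(B <#> X) <#> (?Y <#> B) = B <#> B <#> B"
      using B fX Y by (simp add: B_def set_mult_assoc set_mult_closed)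
    also have "\<dots> = set_pow G B 3"
      using set_pow_1[OF B(2)] by (simp add: eval_nat_numeral)
    finally show ?thesis .
  qed
  moreover have XB: "card X \<le> card B"
    unfolding B_def using fX Y by (intro card_le_card_set_mult_right) auto
  ultimately have "card (set_pow G B 3) \<le> K^12 * card X" by (simp flip: power_add)
  also have "\<dots> \<le> K^12 * card B" using XB K by (intro mult_left_mono) auto
  finally have B3: "card (set_pow G B (m + 3)) \<le> (K^12) ^ (m + 1) * card B" for m
    using card_set_pow_le[OF B(1-3)] B(4) by blast
  \<comment> \<open>Covering with \<open>X\<close> as the small set:
    \<open>|F| |X| \<le> |A X| \<le> K |X|\<close>, hence at most \<open>K\<close>
    translates.\<close>
  obtain F where F: "F \<subseteq> A" "card F * card X \<le> card (A <#> X)" "A \<subseteq> F <#> (X <#> ?Y)"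
    using ruzsa_covering[OF A(1) fX(1) A(2) fX(2) X(2)] .
  have "real (card F) * card X \<le> K * card X"
    using F(2) AX by (metis of_nat_le_iff of_nat_mult order_trans)
  then have "card F \<le> K" using cX by simp
  moreover have "card (set_pow G B (m + 3)) \<le> K ^ (12 * (m + 1)) * card B" for m
    using B3[of m] by (simp only: power_mult)
  moreover have "F \<subseteq> carrier G" "finite F" using F(1) A finite_subset by auto
  ultimately show ?thesis
    using that[of B F] B F(3) unfolding B_def by blast
qed

text \<open>Choose one representative per coset. Its product with an element of \<open>E\<close>
  stays in the same coset, since \<open>E\<close> lies in \<open>H\<close>; so the product
  determines the coset, and then the element of \<open>E\<close>.\<close>

lemma card_cosets_mult_le:
  assumes H: "subgroup H G" and E: "E \<subseteq> H" "finite E" and V: "finite V" "V \<subseteq> carrier G"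
  shows "card ((\<lambda>v. l_coset G v H) ` V) * card E \<le> card (V <#> E)"
proof -
  have HG: "H \<subseteq> carrier G" using H by (rule subgroup.subset)
  define r where "r = inv_into V (\<lambda>v. l_coset G v H)"
  have r: "r c \<in> V \<and> l_coset G (r c) H = c" if "c \<in> (\<lambda>v. l_coset G v H) ` V" for c
    unfolding r_def using inv_into_into[OF that] f_inv_into_f[OF that] by simp
  have absorb: "l_coset G (g \<otimes> h) H = l_coset G g H" if "g \<in> carrier G" "h \<in> H" for g h
    using that lcos_m_assoc[OF HG, of g h] coset_join3[OF _ H, of h] HG by auto
  let ?f = "\<lambda>(c, e). r c \<otimes> e"
  have "inj_on ?f ((\<lambda>v. l_coset G v H) ` V \<times> E)"
  proof (rule inj_onI, clarsimp)
    fix v w e e' assume a: "v \<in> V" "w \<in> V" "e \<in> E" "e' \<in> E"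
      and eq: "r (l_coset G v H) \<otimes> e = r (l_coset G w H) \<otimes> e'"
    have rv: "r (l_coset G v H) \<in> V" "l_coset G (r (l_coset G v H)) H = l_coset G v H" and rw: "r (l_coset G w H) \<in> V" "l_coset G (r (l_coset G w H)) H = l_coset G w H"
      using r a by blast+
    have c: "r (l_coset G v H) \<in> carrier G" "r (l_coset G w H) \<in> carrier G" "e \<in> carrier G" "e' \<in> carrier G"
      "e \<in> H" "e' \<in> H"
      using rv rw V a E HG by auto
    have "l_coset G (r (l_coset G v H)) H = l_coset G (r (l_coset G v H) \<otimes> e) H"
      using c by (simp add: absorb)
    also have "\<dots> = l_coset G (r (l_coset G w H)) H"
      unfolding eq using c by (simp add: absorb)
    finally have vw: "l_coset G v H = l_coset G w H" using rv rw by simp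
    with eq c have "e = e'" by simp
    with vw show "l_coset G v H = l_coset G w H \<and> e = e'" by simp
  qed
  then have "card ((\<lambda>v. l_coset G v H) ` V) * card E = card (?f ` ((\<lambda>v. l_coset G v H) ` V \<times> E))"
    by (simp add: card_image card_cartesian_product)
  also have "\<dots> \<le> card (V <#> E)"
    using V E r by (intro card_mono finite_set_mult) (auto intro!: set_mult_memI)
  finally show ?thesis .
qed

text \<open>The elements of \<open>B\<close> in one coset \<open>b H\<close> are carried by
  \<open>b^-1\<close> into \<open>B^2 \<inter> H\<close>; the most populated coset gives the bound.
  Together with \<open>card_cosets_mult_le\<close> it transfers elements of \<open>H\<close> found
  in a high power of \<open>B\<close> back to \<open>B^2\<close>.\<close>

lemma card_le_cosets_mult:
  assumes H: "subgroup H G" and B: "finite B" "B \<subseteq> carrier G" "set_inv B = B" "B \<noteq> {}"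
  shows "card B \<le> card ((\<lambda>v. l_coset G v H) ` B) * card (set_pow G B 2 \<inter> H)"
proof -
  have HG: "H \<subseteq> carrier G" using H by (rule subgroup.subset)
  obtain b where b: "b \<in> B"
    "card B \<le> card ((\<lambda>v. l_coset G v H) ` B) * card {x \<in> B. l_coset G x H = l_coset G b H}"
    using exists_large_fibre[OF B(1,4), of "\<lambda>v. l_coset G v H"] by blast
  have B2: "set_pow G B 2 = B <#> B"
    using set_pow_1[OF B(2)] by (simp add: eval_nat_numeral)
  have "card {x \<in> B. l_coset G x H = l_coset G b H} \<le> card (set_pow G B 2 \<inter> H)"
  proof (rule card_inj_on_le[of "\<lambda>x. inv b \<otimes> x"])
    show "inj_on (\<lambda>x. inv b \<otimes> x) {x \<in> B. l_coset G x H = l_coset G b H}"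
      using B b by (auto intro!: inj_onI simp: subset_iff)
    show "(\<lambda>x. inv b \<otimes> x) ` {x \<in> B. l_coset G x H = l_coset G b H} \<subseteq> set_pow G B 2 \<inter> H"
    proof (rule image_subsetI)
      fix x assume "x \<in> {x \<in> B. l_coset G x H = l_coset G b H}"
      then have x: "x \<in> B" "l_coset G x H = l_coset G b H" by auto
      have "inv b \<in> B" using B(3) b by (metis image_eqI set_inv_eq_image)
      then have 1: "inv b \<otimes> x \<in> set_pow G B 2" using x by (simp add: B2 set_mult_memI)
      have "x \<in> l_coset G b H" using x B lcos_self[OF _ H, of x] by auto
      then obtain h where "h \<in> H" "x = b \<otimes> h" by (auto simp: l_coset_def)
      then have "inv b \<otimes> x = h" using inv_solve_left'[of h b x] b B HG by auto
      with 1 \<open>h \<in> H\<close> show "inv b \<otimes> x \<in> set_pow G B 2 \<inter> H" by simp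
    qed
    show "finite (set_pow G B 2 \<inter> H)" using B by (simp add: finite_set_pow)
  qed
  then show ?thesis using b(2) by (meson le_trans mult_le_mono2)
qed

lemma card_cosets_set_mult_le:
  assumes H: "H \<subseteq> carrier G" and F: "finite F" "F \<subseteq> carrier G" and B: "finite B" "B \<subseteq> carrier G"
  shows "card ((\<lambda>v. l_coset G v H) ` (F <#> B)) \<le> card F * card ((\<lambda>v. l_coset G v H) ` B)"
proof -
  have "(\<lambda>v. l_coset G v H) ` (F <#> B) \<subseteq> (\<lambda>(f, c). l_coset G f c) ` (F \<times> (\<lambda>v. l_coset G v H) ` B)"
  proof (rule image_subsetI)
    fix v assume "v \<in> F <#> B"
    then obtain f b where fb: "f \<in> F" "b \<in> B" "v = f \<otimes> b" by (auto simp: set_mult_def)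
    then have "l_coset G v H = l_coset G f (l_coset G b H)"
      using lcos_m_assoc[OF H, of f b] F B by auto
    with fb show "l_coset G v H \<in> (\<lambda>(f, c). l_coset G f c) ` (F \<times> (\<lambda>v. l_coset G v H) ` B)"
      by force
  qed
  then have "card ((\<lambda>v. l_coset G v H) ` (F <#> B)) \<le>
      card ((\<lambda>(f, c). l_coset G f c) ` (F \<times> (\<lambda>v. l_coset G v H) ` B))"
    using F B by (intro card_mono) auto
  also have "\<dots> \<le> card (F \<times> (\<lambda>v. l_coset G v H) ` B)"
    using F B by (intro card_image_le) auto
  finally show ?thesis by (simp add: card_cartesian_product)
qed

end

section \<open>Unitary matrices and the Frobenius norm\<close>

declare minus_carrier_mat [simp]

lemma mult_carrier_mat_square [simp]:
  "A \<in> carrier_mat n n \<Longrightarrow> B \<in> carrier_mat n n \<Longrightarrow> A * B \<in> carrier_mat n n"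
  by (rule mult_carrier_mat)

lemma smult_smult: "a \<cdot>\<^sub>m (b \<cdot>\<^sub>m M) = (a * b) \<cdot>\<^sub>m (M :: complex mat)"
  by (rule eq_matI) auto

lemma zero_smult: "M \<in> carrier_mat n m \<Longrightarrow> 0 \<cdot>\<^sub>m M = 0\<^sub>m n m" for M :: "complex mat"
  by (rule eq_matI) auto

lemma minus_eq_zeroD:
  fixes M N :: "complex mat"
  assumes "M - N = 0\<^sub>m n m" "M \<in> carrier_mat n m" "N \<in> carrier_mat n m"
  shows "M = N"
proof (rule eq_matI)
  fix i j assume "i < dim_row N" "j < dim_col N"
  then have "(M - N) $$ (i, j) = M $$ (i, j) - N $$ (i, j)" by (rule index_minus_mat(1))
  moreover have "(M - N) $$ (i, j) = 0"
    using assms \<open>i < dim_row N\<close> \<open>j < dim_col N\<close> unfolding assms(1) by auto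
  ultimately show "M $$ (i, j) = N $$ (i, j)" by simp
qed (use assms in auto)

lemma one_smult: "1 \<cdot>\<^sub>m M = (M :: complex mat)"
  by (rule eq_matI) auto

lemma mult_unitary_group [simp]: "x \<otimes>\<^bsub>unitary_group n\<^esub> y = x * y"
  and one_unitary_group [simp]: "\<one>\<^bsub>unitary_group n\<^esub> = 1\<^sub>m n"
  by (simp_all add: unitary_group_def)

lemma carrier_unitary_group_iff:
  "M \<in> carrier (unitary_group n) \<longleftrightarrow>
    M \<in> carrier_mat n n \<and> mat_adjoint M * M = 1\<^sub>m n \<and> M * mat_adjoint M = 1\<^sub>m n"
  by (simp add: unitary_group_def)

lemma inv_unitary_group:
  assumes "M \<in> carrier (unitary_group n)"
  shows "inv\<^bsub>unitary_group n\<^esub> M = mat_adjoint M"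
  using assms group.inv_equality[OF group_unitary_group, of n "mat_adjoint M" M]
  by (auto simp: carrier_unitary_group_iff mat_adjoint_mat_adjoint)

lemma unitary_cancel_left:
  assumes "M \<in> carrier (unitary_group n)" "X \<in> carrier_mat n n"
  shows "mat_adjoint M * (M * X) = X" "M * (mat_adjoint M * X) = X"
proof -
  have M: "M \<in> carrier_mat n n" "mat_adjoint M \<in> carrier_mat n n"
    "mat_adjoint M * M = 1\<^sub>m n" "M * mat_adjoint M = 1\<^sub>m n"
    using assms by (auto simp: carrier_unitary_group_iff)
  show "mat_adjoint M * (M * X) = X" "M * (mat_adjoint M * X) = X"
    using assoc_mult_mat[OF M(2,1) assms(2)] assoc_mult_mat[OF M(1,2) assms(2)] M(3,4) assms(2)
    by simp_all
qed

lemma adjoint_smult: "mat_adjoint (c \<cdot>\<^sub>m M) = cnj c \<cdot>\<^sub>m mat_adjoint (M :: complex mat)"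
  by (rule eq_matI) (auto simp: index_mat_adjoint)

lemma adjoint_minus:
  assumes "M \<in> carrier_mat n m" "N \<in> carrier_mat n m"
  shows "mat_adjoint (M - N) = mat_adjoint M - mat_adjoint (N :: complex mat)"
  using assms by (intro eq_matI) (auto simp: index_mat_adjoint)

lemma mat_mult_index:
  assumes "A \<in> carrier_mat n m" "B \<in> carrier_mat m k" "i < n" "j < k"
  shows "(A * B) $$ (i, j) = (\<Sum>l<m. A $$ (i, l) * B $$ (l, j))"
  using assms by (simp add: scalar_prod_def atLeast0LessThan)

text \<open>The Frobenius norm suits the argument better than the operator norm: its square is a
  trace, so unitary invariance is pure algebra, and it bounds traces of products by
  Cauchy-Schwarz.\<close>

definition frob :: "complex mat \<Rightarrow> real" where
  "frob M = L2_set (\<lambda>ij. cmod (M $$ ij)) ({..<dim_row M} \<times> {..<dim_col M})"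

definition mtrace :: "complex mat \<Rightarrow> complex" where
  "mtrace M = (\<Sum>i<dim_row M. M $$ (i, i))"

lemma frob_nonneg [simp]: "0 \<le> frob M"
  by (simp add: frob_def)

lemma frob_power2:
  assumes "M \<in> carrier_mat n m"
  shows "(frob M)\<^sup>2 = (\<Sum>i<n. \<Sum>j<m. (cmod (M $$ (i, j)))\<^sup>2)"
  using assms by (simp add: frob_def L2_set_def sum_nonneg sum.cartesian_product)

lemma frob_eq_0_iff:
  assumes "M \<in> carrier_mat n m"
  shows "frob M = 0 \<longleftrightarrow> M = 0\<^sub>m n m"
  using assms by (auto simp: frob_def L2_set_eq_0_iff intro!: eq_matI)

lemma mtrace_adjoint_mult:
  assumes "M \<in> carrier_mat n n"
  shows "mtrace (mat_adjoint M * M) = of_real ((frob M)\<^sup>2)"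
proof -
  have "mtrace (mat_adjoint M * M) = (\<Sum>j<n. \<Sum>i<n. cnj (M $$ (i, j)) * M $$ (i, j))"
    using assms by (auto simp: mtrace_def mat_mult_index[of _ n n _ n] index_mat_adjoint intro!: sum.cong simp del: index_mult_mat(1))
  also have "\<dots> = (\<Sum>i<n. \<Sum>j<n. cnj (M $$ (i, j)) * M $$ (i, j))"
    by (rule sum.swap)
  also have "\<dots> = of_real ((frob M)\<^sup>2)"
    unfolding frob_power2[OF assms] of_real_sum complex_norm_square by (simp add: mult.commute)
  finally show ?thesis .
qed

lemma mtrace_mult_commute:
  assumes "A \<in> carrier_mat n n" "B \<in> carrier_mat n n"
  shows "mtrace (A * B) = mtrace (B * A)"
proof -
  have "mtrace (A * B) = (\<Sum>i<n. \<Sum>j<n. A $$ (i, j) * B $$ (j, i))"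
    using assms by (auto simp: mtrace_def mat_mult_index[of _ n n _ n] intro!: sum.cong simp del: index_mult_mat(1))
  also have "\<dots> = (\<Sum>j<n. \<Sum>i<n. A $$ (i, j) * B $$ (j, i))" by (rule sum.swap)
  also have "\<dots> = mtrace (B * A)"
    using assms by (auto simp: mtrace_def mat_mult_index[of _ n n _ n] mult.commute intro!: sum.cong simp del: index_mult_mat(1))
  finally show ?thesis .
qed

lemma frob_adjoint:
  assumes "M \<in> carrier_mat n n"
  shows "frob (mat_adjoint M) = frob M"
proof -
  have "complex_of_real ((frob (mat_adjoint M))\<^sup>2) = of_real ((frob M)\<^sup>2)"
    using assms mtrace_adjoint_mult[of M n] mtrace_adjoint_mult[of "mat_adjoint M" n]
      mtrace_mult_commute[of M n "mat_adjoint M"]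
    by (simp add: mat_adjoint_mat_adjoint)
  then have "(frob (mat_adjoint M))\<^sup>2 = (frob M)\<^sup>2" by (simp only: of_real_eq_iff)
  then show ?thesis by (simp add: power2_eq_iff_nonneg)
qed

text \<open>Reduces equality of norms to a matrix identity. This serves for unitary invariance and
  for the comparison of a normal matrix with its adjoint.\<close>

lemma frob_eqI:
  assumes "M \<in> carrier_mat n n" "N \<in> carrier_mat n n"
    and "mat_adjoint M * M = mat_adjoint N * N"
  shows "frob M = frob N"
proof -
  have "complex_of_real ((frob M)\<^sup>2) = of_real ((frob N)\<^sup>2)"
    using assms mtrace_adjoint_mult[of M n] mtrace_adjoint_mult[of N n] by simp
  then have "(frob M)\<^sup>2 = (frob N)\<^sup>2" by (simp only: of_real_eq_iff)
  then show ?thesis by (simp add: power2_eq_iff_nonneg)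
qed

lemma frob_unitary_mult:
  assumes "V \<in> carrier (unitary_group n)" "M \<in> carrier_mat n n"
  shows "frob (V * M) = frob M"
proof (rule frob_eqI)
  show "mat_adjoint (V * M) * (V * M) = mat_adjoint M * M"
  proof -
    have V: "V \<in> carrier_mat n n" using assms by (simp add: carrier_unitary_group_iff)
    have "mat_adjoint (V * M) * (V * M) = mat_adjoint M * (mat_adjoint V * (V * M))"
      using V assms(2) by (simp add: mat_adjoint_mult[of _ n n _ n] assoc_mult_mat[of _ n n _ n _ n])
    then show ?thesis using unitary_cancel_left[OF assms] by simp
  qed
qed (use assms in \<open>auto simp: carrier_unitary_group_iff\<close>)

lemma frob_mult_unitary:
  assumes "V \<in> carrier (unitary_group n)" "M \<in> carrier_mat n n"
  shows "frob (M * V) = frob M"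
proof -
  have V: "V \<in> carrier_mat n n" "mat_adjoint V \<in> carrier (unitary_group n)"
    using assms by (auto simp: carrier_unitary_group_iff mat_adjoint_mat_adjoint)
  have "frob (M * V) = frob (mat_adjoint V * mat_adjoint M)"
    using V assms frob_adjoint[of "M * V" n] by (simp add: mat_adjoint_mult[of _ n n _ n])
  also have "\<dots> = frob M"
    using V assms by (simp add: frob_unitary_mult frob_adjoint)
  finally show ?thesis .
qed

lemma frob_smult: "frob (c \<cdot>\<^sub>m M) = cmod c * frob M"
proof -
  have "frob (c \<cdot>\<^sub>m M) = L2_set (\<lambda>ij. cmod c * cmod (M $$ ij)) ({..<dim_row M} \<times> {..<dim_col M})"
    unfolding frob_def by (auto simp: norm_mult intro!: L2_set_cong)
  then show ?thesis by (simp add: frob_def L2_set_right_distrib)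
qed

lemma frob_diff_le:
  assumes "M \<in> carrier_mat n m" "N \<in> carrier_mat n m"
  shows "frob (M - N) \<le> frob M + frob N"
proof -
  have "frob (M - N) \<le> L2_set (\<lambda>ij. cmod (M $$ ij) + cmod (N $$ ij)) ({..<n} \<times> {..<m})"
    unfolding frob_def using assms
    by (auto intro!: L2_set_mono norm_triangle_ineq4 simp: minus_carrier_mat)
  also have "\<dots> \<le> frob M + frob N"
    unfolding frob_def using assms by (auto intro!: L2_set_triangle_ineq[THEN order_trans])
  finally show ?thesis .
qed

lemma cmod_sum_mult_power2_le:
  fixes f g :: "'a \<Rightarrow> complex"
  shows "(cmod (\<Sum>x\<in>S. f x * g x))\<^sup>2 \<le> (\<Sum>x\<in>S. (cmod (f x))\<^sup>2) * (\<Sum>x\<in>S. (cmod (g x))\<^sup>2)"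
proof -
  have "cmod (\<Sum>x\<in>S. f x * g x) \<le> (\<Sum>x\<in>S. \<bar>cmod (f x)\<bar> * \<bar>cmod (g x)\<bar>)"
    by (rule order_trans[OF norm_sum]) (simp add: norm_mult)
  also have "\<dots> \<le> L2_set (\<lambda>x. cmod (f x)) S * L2_set (\<lambda>x. cmod (g x)) S"
    by (rule L2_set_mult_ineq)
  finally have "(cmod (\<Sum>x\<in>S. f x * g x))\<^sup>2 \<le> (L2_set (\<lambda>x. cmod (f x)) S * L2_set (\<lambda>x. cmod (g x)) S)\<^sup>2"
    by (intro power_mono) auto
  then show ?thesis by (simp add: power_mult_distrib L2_set_def sum_nonneg)
qed

lemma frob_mult_le:
  assumes "M \<in> carrier_mat n n" "N \<in> carrier_mat n n"
  shows "frob (M * N) \<le> frob M * frob N"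
proof -
  have "(frob (M * N))\<^sup>2 = (\<Sum>i<n. \<Sum>j<n. (cmod (\<Sum>k<n. M $$ (i, k) * N $$ (k, j)))\<^sup>2)"
    using assms frob_power2[of "M * N" n n] by (simp add: mat_mult_index[of _ n n _ n] del: index_mult_mat)
  also have "\<dots> \<le> (\<Sum>i<n. \<Sum>j<n. (\<Sum>k<n. (cmod (M $$ (i, k)))\<^sup>2) * (\<Sum>k<n. (cmod (N $$ (k, j)))\<^sup>2))"
    by (intro sum_mono cmod_sum_mult_power2_le)
  also have "\<dots> = (\<Sum>i<n. \<Sum>k<n. (cmod (M $$ (i, k)))\<^sup>2) * (\<Sum>j<n. \<Sum>k<n. (cmod (N $$ (k, j)))\<^sup>2)"
    by (simp add: sum_product)
  also have "(\<Sum>j<n. \<Sum>k<n. (cmod (N $$ (k, j)))\<^sup>2) = (\<Sum>k<n. \<Sum>j<n. (cmod (N $$ (k, j)))\<^sup>2)"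
    by (rule sum.swap)
  finally have "(frob (M * N))\<^sup>2 \<le> (frob M * frob N)\<^sup>2"
    using assms by (simp add: frob_power2 power_mult_distrib)
  then show ?thesis by (rule power2_le_imp_le) simp
qed

lemma cmod_mtrace_mult_le:
  assumes "M \<in> carrier_mat n n" "N \<in> carrier_mat n n"
  shows "cmod (mtrace (M * N)) \<le> frob M * frob N"
proof -
  have "mtrace (M * N) = (\<Sum>(i, j)\<in>{..<n} \<times> {..<n}. M $$ (i, j) * N $$ (j, i))"
    using assms by (auto simp: mtrace_def mat_mult_index[of _ n n _ n] sum.cartesian_product[symmetric] intro!: sum.cong simp del: index_mult_mat(1))
  then have "(cmod (mtrace (M * N)))\<^sup>2 \<le> (\<Sum>x\<in>{..<n} \<times> {..<n}. (cmod (M $$ x))\<^sup>2) *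
      (\<Sum>(i, j)\<in>{..<n} \<times> {..<n}. (cmod (N $$ (j, i)))\<^sup>2)"
    using cmod_sum_mult_power2_le[of "\<lambda>x. M $$ x" "\<lambda>(i, j). N $$ (j, i)" "{..<n} \<times> {..<n}"]
    by (simp add: case_prod_unfold)
  also have "(\<Sum>(i, j)\<in>{..<n} \<times> {..<n}. (cmod (N $$ (j, i)))\<^sup>2) = (frob N)\<^sup>2"
    unfolding frob_power2[OF assms(2)] sum.cartesian_product[symmetric] by (rule sum.swap)
  also have "(\<Sum>x\<in>{..<n} \<times> {..<n}. (cmod (M $$ x))\<^sup>2) = (frob M)\<^sup>2"
    unfolding frob_power2[OF assms(1)] sum.cartesian_product by (simp add: case_prod_unfold)
  finally have "(cmod (mtrace (M * N)))\<^sup>2 \<le> (frob M * frob N)\<^sup>2" by (simp add: power_mult_distrib)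
  then show ?thesis by (rule power2_le_imp_le) simp
qed

text \<open>Right multiplication by \<open>x\<close> preserves the norm and turns the difference
  into the commutator \<open>x g - g x\<close>, which equals that of \<open>x - 1\<close> and
  \<open>g - 1\<close>. The bound is therefore of second order: conjugation by \<open>x\<close> near
  1 moves \<open>g\<close> far less than the distance from \<open>g\<close> to 1.\<close>

lemma frob_conj_diff_le:
  assumes x: "x \<in> carrier (unitary_group n)" and g: "g \<in> carrier (unitary_group n)"
  shows "frob (x * g * mat_adjoint x - g) \<le> 2 * frob (x - 1\<^sub>m n) * frob (g - 1\<^sub>m n)"
proof -
  have c: "x \<in> carrier_mat n n" "g \<in> carrier_mat n n" "x * mat_adjoint x = 1\<^sub>m n"
    "mat_adjoint x * x = 1\<^sub>m n"
    using x g by (auto simp: carrier_unitary_group_iff)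
  have "(x * g * mat_adjoint x - g) * x = x * g - g * x"
    using c by (simp add: minus_mult_distrib_mat[of _ n n _ _ n] assoc_mult_mat[of _ n n _ n _ n])
  also have "\<dots> = (x - 1\<^sub>m n) * (g - 1\<^sub>m n) - (g - 1\<^sub>m n) * (x - 1\<^sub>m n)"
  proof -
    have "(y - 1\<^sub>m n) * (z - 1\<^sub>m n) = y * z - z - (y - 1\<^sub>m n)"
      if "y \<in> carrier_mat n n" "z \<in> carrier_mat n n" for y z :: "complex mat"
      using that by (simp add: minus_mult_distrib_mat[of _ n n _ _ n] mult_minus_distrib_mat[of _ n n _ n])
    moreover have "x * g - g * x = (x * g - g - (x - 1\<^sub>m n)) - (g * x - x - (g - 1\<^sub>m n))"
      using c by (intro eq_matI) (auto simp del: index_mult_mat(1))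
    ultimately show ?thesis using c by simp
  qed
  finally have "frob (x * g * mat_adjoint x - g) =
      frob ((x - 1\<^sub>m n) * (g - 1\<^sub>m n) - (g - 1\<^sub>m n) * (x - 1\<^sub>m n))"
    using frob_mult_unitary[OF x, of "x * g * mat_adjoint x - g"] c by simp
  also have "\<dots> \<le> frob ((x - 1\<^sub>m n) * (g - 1\<^sub>m n)) + frob ((g - 1\<^sub>m n) * (x - 1\<^sub>m n))"
    using c by (intro frob_diff_le[of _ n n]) auto
  also have "\<dots> \<le> frob (x - 1\<^sub>m n) * frob (g - 1\<^sub>m n) + frob (g - 1\<^sub>m n) * frob (x - 1\<^sub>m n)"
    using c by (intro add_mono frob_mult_le[of _ n]) auto
  finally show ?thesis by (simp add: mult_ac)
qed

lemma frob_adjoint_mult_minus_one: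
  assumes x: "x \<in> carrier (unitary_group n)" and y: "y \<in> carrier_mat n n"
  shows "frob (mat_adjoint x * y - 1\<^sub>m n) = frob (y - x)"
proof -
  have c: "x \<in> carrier_mat n n" using x by (simp add: carrier_unitary_group_iff)
  have "x * (mat_adjoint x * y - 1\<^sub>m n) = y - x"
    using c y x unitary_cancel_left[OF x y] by (simp add: mult_minus_distrib_mat[of _ n n _ n])
  then show ?thesis using frob_unitary_mult[OF x, of "mat_adjoint x * y - 1\<^sub>m n"] c y by simp
qed

section \<open>Systems of orthogonal projections\<close>

text \<open>Orthogonal decompositions of the whole space into nonzero subspaces. The condition that
  the projections sum to 1 is stated entrywise, because the zero matrix depends on the dimension.
  Nonzero members are what bounds their number.\<close>

definition proj_system :: "nat \<Rightarrow> complex mat set \<Rightarrow> bool" where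
  "proj_system n \<E> \<longleftrightarrow> finite \<E> \<and>
     (\<forall>E\<in>\<E>. E \<in> carrier_mat n n \<and> mat_adjoint E = E \<and> E * E = E \<and> E \<noteq> 0\<^sub>m n n) \<and>
     (\<forall>E\<in>\<E>. \<forall>F\<in>\<E>. E \<noteq> F \<longrightarrow> E * F = 0\<^sub>m n n) \<and>
     (\<forall>i<n. \<forall>j<n. (\<Sum>E\<in>\<E>. E $$ (i, j)) = 1\<^sub>m n $$ (i, j))"

text \<open>The block-diagonal unitary matrices, that is, the product of the unitary groups of the
  ranges of the projections.\<close>

definition commutant :: "nat \<Rightarrow> complex mat set \<Rightarrow> complex mat set" where
  "commutant n \<E> = {M \<in> carrier (unitary_group n). \<forall>E\<in>\<E>. M * E = E * M}"

text \<open>Since the projections sum to the identity, these are exactly the sums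
  \<open>\<Sum>E\<in>\<E>. z E \<cdot> E\<close> with all \<open>z E\<close> on the unit circle.\<close>

definition proj_torus :: "nat \<Rightarrow> complex mat set \<Rightarrow> complex mat set" where
  "proj_torus n \<E> = {M \<in> carrier (unitary_group n). \<forall>E\<in>\<E>. \<exists>z. M * E = z \<cdot>\<^sub>m E}"

lemma commutant_carrier:
  assumes "M \<in> commutant n \<E>"
  shows "M \<in> carrier (unitary_group n)" "M \<in> carrier_mat n n"
  using assms unfolding commutant_def carrier_unitary_group_iff by blast+

lemma proj_torus_carrier:
  assumes "M \<in> proj_torus n \<E>"
  shows "M \<in> carrier (unitary_group n)" "M \<in> carrier_mat n n"
  using assms unfolding proj_torus_def carrier_unitary_group_iff by blast+

lemma proj_torusE:
  assumes "M \<in> proj_torus n \<E>" "E \<in> \<E>"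
  obtains z where "M * E = z \<cdot>\<^sub>m E"
  using assms unfolding proj_torus_def by blast

lemma proj_systemD:
  assumes "proj_system n \<E>"
  shows "finite \<E>"
    and "E \<in> \<E> \<Longrightarrow> E \<in> carrier_mat n n" "E \<in> \<E> \<Longrightarrow> mat_adjoint E = E"
    "E \<in> \<E> \<Longrightarrow> E * E = E" "E \<in> \<E> \<Longrightarrow> E \<noteq> 0\<^sub>m n n"
    and "E \<in> \<E> \<Longrightarrow> F \<in> \<E> \<Longrightarrow> E \<noteq> F \<Longrightarrow> E * F = 0\<^sub>m n n"
    and "i < n \<Longrightarrow> j < n \<Longrightarrow> (\<Sum>E\<in>\<E>. E $$ (i, j)) = 1\<^sub>m n $$ (i, j)"
  using assms unfolding proj_system_def by blast+

lemma proj_system_expand: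
  assumes S: "proj_system n \<E>" and X: "X \<in> carrier_mat n n" and ij: "i < n" "j < n"
  shows "X $$ (i, j) = (\<Sum>E\<in>\<E>. (X * E) $$ (i, j))"
proof -
  have "X $$ (i, j) = (X * 1\<^sub>m n) $$ (i, j)" using X by simp
  also have "\<dots> = (\<Sum>k<n. X $$ (i, k) * 1\<^sub>m n $$ (k, j))"
    using X ij by (intro mat_mult_index) auto
  also have "\<dots> = (\<Sum>k<n. \<Sum>E\<in>\<E>. X $$ (i, k) * E $$ (k, j))"
    using ij by (intro sum.cong refl)
      (simp only: lessThan_iff proj_systemD(7)[OF S, symmetric] sum_distrib_left)
  also have "\<dots> = (\<Sum>E\<in>\<E>. \<Sum>k<n. X $$ (i, k) * E $$ (k, j))" by (rule sum.swap)
  also have "\<dots> = (\<Sum>E\<in>\<E>. (X * E) $$ (i, j))"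
    using X ij proj_systemD(2)[OF S]
    by (intro sum.cong) (auto simp: mat_mult_index[of _ n n _ n] simp del: index_mult_mat(1))
  finally show ?thesis .
qed

text \<open>The projections sum to 1, so a matrix is determined by its products with them.
  Identities can then be checked one block at a time.\<close>

lemma proj_system_ext:
  assumes S: "proj_system n \<E>" and "X \<in> carrier_mat n n" "Y \<in> carrier_mat n n"
    and "\<And>E. E \<in> \<E> \<Longrightarrow> X * E = Y * E"
  shows "X = Y"
proof (rule eq_matI)
  fix i j assume "i < dim_row Y" "j < dim_col Y"
  then have "i < n" "j < n" using assms by auto
  then show "X $$ (i, j) = Y $$ (i, j)"
    using assms by (simp add: proj_system_expand[OF S, of X] proj_system_expand[OF S, of Y] del: index_mult_mat(1))
qed (use assms in auto)

text \<open>Since \<open>E = E * E\<close>, submultiplicativity gives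
  \<open>frob E \<le> frob E * frob E\<close>, so a nonzero projection has norm at least 1. This
  replaces the statement that its rank is at least 1.\<close>

lemma mtrace_proj:
  assumes S: "proj_system n \<E>" and E: "E \<in> \<E>"
  shows "mtrace E = of_real ((frob E)\<^sup>2)" "frob E \<ge> 1"
proof -
  note D = proj_systemD(2-5)[OF S E]
  show "mtrace E = of_real ((frob E)\<^sup>2)" using mtrace_adjoint_mult[of E n] D by simp
  have "frob E \<noteq> 0" using frob_eq_0_iff[of E n n] D by simp
  then have "0 < frob E" using frob_nonneg[of E] by linarith
  moreover have "frob E * 1 \<le> frob E * frob E" using frob_mult_le[of E n E] D by simp
  ultimately show "frob E \<ge> 1" using mult_le_cancel_left_pos by blast
qed

text \<open>The squared norms add up to the trace \<open>n\<close> of the identity, and each is at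
  least 1. This is what ends the descent.\<close>

lemma card_proj_system_le:
  assumes S: "proj_system n \<E>"
  shows "card \<E> \<le> n"
proof -
  have "complex_of_real (\<Sum>E\<in>\<E>. (frob E)\<^sup>2) = (\<Sum>E\<in>\<E>. mtrace E)"
    using mtrace_proj[OF S] by simp
  also have "\<dots> = (\<Sum>E\<in>\<E>. \<Sum>i<n. E $$ (i, i))"
    using proj_systemD(2)[OF S] by (intro sum.cong) (auto simp: mtrace_def)
  also have "\<dots> = (\<Sum>i<n. \<Sum>E\<in>\<E>. E $$ (i, i))" by (rule sum.swap)
  also have "\<dots> = of_nat n" using proj_systemD(7)[OF S] by simp
  also have "\<dots> = complex_of_real (real n)" by simp
  finally have "(\<Sum>E\<in>\<E>. (frob E)\<^sup>2) = real n" by (simp only: of_real_eq_iff)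
  moreover have "(\<Sum>E\<in>\<E>. 1) \<le> (\<Sum>E\<in>\<E>. (frob E)\<^sup>2)"
    using mtrace_proj(2)[OF S] by (intro sum_mono) simp
  ultimately show ?thesis by simp
qed

lemma proj_system_one:
  assumes "n \<ge> 1"
  shows "proj_system n {1\<^sub>m n}"
proof -
  have "(1\<^sub>m n :: complex mat) \<noteq> 0\<^sub>m n n"
  proof
    assume "(1\<^sub>m n :: complex mat) = 0\<^sub>m n n"
    then have "(1\<^sub>m n :: complex mat) $$ (0, 0) = 0\<^sub>m n n $$ (0, 0)" by simp
    then show False using assms by simp
  qed
  then show ?thesis by (auto simp: proj_system_def mat_adjoint_one)
qed

lemma commutant_one: "commutant n {1\<^sub>m n} = carrier (unitary_group n)"
  by (auto simp: commutant_def carrier_unitary_group_iff)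

lemma subgroup_commutant:
  assumes S: "proj_system n \<E>"
  shows "subgroup (commutant n \<E>) (unitary_group n)"
proof (rule group.subgroupI[OF group_unitary_group])
  show "commutant n \<E> \<subseteq> carrier (unitary_group n)" by (auto simp: commutant_def)
  have "1\<^sub>m n * E = E * 1\<^sub>m n" if "E \<in> \<E>" for E
    using proj_systemD(2)[OF S that] by simp
  then have "1\<^sub>m n \<in> commutant n \<E>"
    by (auto simp: commutant_def carrier_unitary_group_iff mat_adjoint_one)
  then show "commutant n \<E> \<noteq> {}" by auto
next
  fix M assume M: "M \<in> commutant n \<E>"
  then have Mc: "M \<in> carrier (unitary_group n)" "M \<in> carrier_mat n n"
    by (auto dest: commutant_carrier)
  have "mat_adjoint M * E = E * mat_adjoint M" if "E \<in> \<E>" for E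
  proof -
    note E = proj_systemD(2,3)[OF S that]
    have "mat_adjoint (E * M) = mat_adjoint (M * E)" using M that by (auto simp: commutant_def)
    then show ?thesis using E Mc by (simp add: mat_adjoint_mult[of _ n n _ n])
  qed
  then show "inv\<^bsub>unitary_group n\<^esub> M \<in> commutant n \<E>"
    using Mc group.inv_closed[OF group_unitary_group Mc(1)]
    by (simp add: inv_unitary_group commutant_def)
next
  fix M N assume MN: "M \<in> commutant n \<E>" "N \<in> commutant n \<E>"
  then have c: "M \<in> carrier_mat n n" "N \<in> carrier_mat n n"
    by (auto dest: commutant_carrier)
  have "M * N * E = E * (M * N)" if "E \<in> \<E>" for E
  proof -
    note E = proj_systemD(2)[OF S that]
    have "M * N * E = M * (E * N)" using MN c E that by (simp add: commutant_def)
    also have "\<dots> = M * E * N" using c E by simp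
    also have "\<dots> = E * M * N" using MN that by (simp add: commutant_def)
    finally show ?thesis using c E by simp
  qed
  moreover have "M * N \<in> carrier (unitary_group n)"
    using monoid.m_closed[OF group.is_monoid[OF group_unitary_group], of M n N] MN
    by (simp add: commutant_def)
  ultimately show "M \<otimes>\<^bsub>unitary_group n\<^esub> N \<in> commutant n \<E>"
    by (simp add: commutant_def)
qed

lemma subgroup_proj_torus:
  assumes S: "proj_system n \<E>"
  shows "subgroup (proj_torus n \<E>) (unitary_group n)"
proof (rule group.subgroupI[OF group_unitary_group])
  show "proj_torus n \<E> \<subseteq> carrier (unitary_group n)" by (auto simp: proj_torus_def)
  have "1\<^sub>m n * E = 1 \<cdot>\<^sub>m E" if "E \<in> \<E>" for E
    using proj_systemD(2)[OF S that] by auto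
  then have "1\<^sub>m n \<in> proj_torus n \<E>"
    by (auto simp: proj_torus_def carrier_unitary_group_iff mat_adjoint_one)
  then show "proj_torus n \<E> \<noteq> {}" by auto
next
  fix M assume M: "M \<in> proj_torus n \<E>"
  then have Mc: "M \<in> carrier (unitary_group n)" "M \<in> carrier_mat n n"
    by (auto dest: proj_torus_carrier)
  have "\<exists>z. mat_adjoint M * E = z \<cdot>\<^sub>m E" if "E \<in> \<E>" for E
  proof -
    note E = proj_systemD(2,5)[OF S that]
    obtain z where z: "M * E = z \<cdot>\<^sub>m E" using proj_torusE[OF M \<open>E \<in> \<E>\<close>] .
    \<comment> \<open>Cancelling \<open>M\<close> shows that the scalar is nonzero and that its
      inverse is the scalar of the adjoint.\<close>
    have e: "E = z \<cdot>\<^sub>m (mat_adjoint M * E)"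
      using unitary_cancel_left(1)[OF Mc(1) E(1)] z Mc E
      by (simp add: mult_smult_distrib[of _ n n _ n])
    then have "z \<noteq> 0" using E Mc by (metis mat_adjoint_carrier mult_carrier_mat_square zero_smult)
    then have "mat_adjoint M * E = (1 / z) \<cdot>\<^sub>m (z \<cdot>\<^sub>m (mat_adjoint M * E))"
      by (intro eq_matI) auto
    with e show ?thesis by metis
  qed
  then show "inv\<^bsub>unitary_group n\<^esub> M \<in> proj_torus n \<E>"
    using Mc group.inv_closed[OF group_unitary_group Mc(1)]
    by (simp add: inv_unitary_group proj_torus_def)
next
  fix M N assume MN: "M \<in> proj_torus n \<E>" "N \<in> proj_torus n \<E>"
  then have c: "M \<in> carrier_mat n n" "N \<in> carrier_mat n n"
    by (auto dest: proj_torus_carrier)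
  have "\<exists>z. M * N * E = z \<cdot>\<^sub>m E" if "E \<in> \<E>" for E
  proof -
    note E = proj_systemD(2)[OF S that]
    obtain z where "M * E = z \<cdot>\<^sub>m E" using proj_torusE[OF MN(1) \<open>E \<in> \<E>\<close>] .
    moreover obtain w where "N * E = w \<cdot>\<^sub>m E" using proj_torusE[OF MN(2) \<open>E \<in> \<E>\<close>] .
    ultimately have "M * N * E = (w * z) \<cdot>\<^sub>m E"
      using c E by (simp add: mult_smult_distrib[of _ n n _ n] smult_smult)
    then show ?thesis ..
  qed
  moreover have "M * N \<in> carrier (unitary_group n)"
    using monoid.m_closed[OF group.is_monoid[OF group_unitary_group], of M n N] MN
    by (simp add: proj_torus_def)
  ultimately show "M \<otimes>\<^bsub>unitary_group n\<^esub> N \<in> proj_torus n \<E>"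
    by (simp add: proj_torus_def)
qed

lemma proj_torus_commute:
  assumes S: "proj_system n \<E>" and M: "M \<in> proj_torus n \<E>" and N: "N \<in> proj_torus n \<E>"
  shows "M * N = N * M"
proof (rule proj_system_ext[OF S])
  show c: "M * N \<in> carrier_mat n n" "N * M \<in> carrier_mat n n"
    using M N by (auto dest!: proj_torus_carrier)
  fix E assume E: "E \<in> \<E>"
  have c: "M \<in> carrier_mat n n" "N \<in> carrier_mat n n" "E \<in> carrier_mat n n"
    using M N proj_systemD(2)[OF S E] by (auto dest!: proj_torus_carrier)
  obtain z where "M * E = z \<cdot>\<^sub>m E" using proj_torusE[OF M E] .
  moreover obtain w where "N * E = w \<cdot>\<^sub>m E" using proj_torusE[OF N E] .
  ultimately show "M * N * E = N * M * E"
    using c by (simp add: mult_smult_distrib[of _ n n _ n] smult_smult mult.commute)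
qed

lemma comm_group_proj_torus:
  assumes S: "proj_system n \<E>"
  shows "comm_group (unitary_group n\<lparr>carrier := proj_torus n \<E>\<rparr>)"
proof (rule group.group_comm_groupI)
  show "group (unitary_group n\<lparr>carrier := proj_torus n \<E>\<rparr>)"
    using subgroup.subgroup_is_group[OF subgroup_proj_torus[OF S] group_unitary_group] .
qed (use proj_torus_commute[OF S] in simp)

section \<open>Angle coordinates on the torus and its connectedness\<close>

definition proj_comb :: "nat \<Rightarrow> complex mat set \<Rightarrow> (complex mat \<Rightarrow> complex) \<Rightarrow> complex mat" where
  "proj_comb n \<E> z = mat n n (\<lambda>ij. \<Sum>E\<in>\<E>. z E * E $$ ij)"

lemma proj_comb_carrier [simp]: "proj_comb n \<E> z \<in> carrier_mat n n"
  by (simp add: proj_comb_def)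

lemma proj_comb_mult:
  assumes S: "proj_system n \<E>" and F: "F \<in> \<E>"
  shows "proj_comb n \<E> z * F = z F \<cdot>\<^sub>m F"
proof (rule eq_matI)
  note Fc = proj_systemD(2)[OF S F]
  fix i j assume "i < dim_row (z F \<cdot>\<^sub>m F)" "j < dim_col (z F \<cdot>\<^sub>m F)"
  then have ij: "i < n" "j < n" using Fc by auto
  have "(proj_comb n \<E> z * F) $$ (i, j) = (\<Sum>k<n. (\<Sum>E\<in>\<E>. z E * E $$ (i, k)) * F $$ (k, j))"
    using ij Fc by (subst mat_mult_index[of _ n n _ n]) (auto simp: proj_comb_def)
  also have "\<dots> = (\<Sum>E\<in>\<E>. \<Sum>k<n. z E * (E $$ (i, k) * F $$ (k, j)))"
    by (simp add: sum_distrib_right mult.assoc) (rule sum.swap)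
  also have "\<dots> = (\<Sum>E\<in>\<E>. z E * (E * F) $$ (i, j))"
    using ij Fc proj_systemD(2)[OF S]
    by (intro sum.cong) (auto simp: mat_mult_index[of _ n n _ n] sum_distrib_left simp del: index_mult_mat(1))
  also have "\<dots> = (\<Sum>E\<in>\<E>. if E = F then z F * F $$ (i, j) else 0)"
    using ij F proj_systemD(4)[OF S F] proj_systemD(6)[OF S]
    by (intro sum.cong) (auto simp del: index_mult_mat(1))
  also have "\<dots> = (z F \<cdot>\<^sub>m F) $$ (i, j)"
    using F Fc ij proj_systemD(1)[OF S] by simp
  finally show "(proj_comb n \<E> z * F) $$ (i, j) = (z F \<cdot>\<^sub>m F) $$ (i, j)" .
qed (use proj_systemD(2)[OF S F] in \<open>auto simp: proj_comb_def\<close>)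

lemma adjoint_proj_comb:
  assumes S: "proj_system n \<E>"
  shows "mat_adjoint (proj_comb n \<E> z) = proj_comb n \<E> (\<lambda>E. cnj (z E))"
proof (rule eq_matI)
  fix i j assume "i < dim_row (proj_comb n \<E> (\<lambda>E. cnj (z E)))" "j < dim_col (proj_comb n \<E> (\<lambda>E. cnj (z E)))"
  then have ij: "i < n" "j < n" by (auto simp: proj_comb_def)
  have "cnj (E $$ (j, i)) = E $$ (i, j)" if "E \<in> \<E>" for E
    using index_mat_adjoint[of i E j] proj_systemD(2,3)[OF S that] ij by simp
  then show "mat_adjoint (proj_comb n \<E> z) $$ (i, j) = proj_comb n \<E> (\<lambda>E. cnj (z E)) $$ (i, j)"
    using ij by (simp add: index_mat_adjoint proj_comb_def)
qed (auto simp: proj_comb_def)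

lemma proj_comb_mem_torus:
  assumes S: "proj_system n \<E>" and z: "\<And>E. E \<in> \<E> \<Longrightarrow> cmod (z E) = 1"
  shows "proj_comb n \<E> z \<in> proj_torus n \<E>"
proof -
  have inv: "proj_comb n \<E> v * proj_comb n \<E> w = 1\<^sub>m n" if "\<And>E. E \<in> \<E> \<Longrightarrow> v E * w E = 1" for v w
  proof (rule proj_system_ext[OF S])
    fix E assume E: "E \<in> \<E>"
    note Ec = proj_systemD(2)[OF S E]
    have "proj_comb n \<E> v * proj_comb n \<E> w * E = (v E * w E) \<cdot>\<^sub>m E"
      using Ec by (simp add: assoc_mult_mat[of _ n n _ n _ n] proj_comb_mult[OF S E]
          mult_smult_distrib[of _ n n _ n] smult_smult mult.commute)
    then show "proj_comb n \<E> v * proj_comb n \<E> w * E = 1\<^sub>m n * E"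
      using Ec that[OF E] by auto
  qed (auto intro: mult_carrier_mat[of _ n n])
  have "z E * cnj (z E) = 1" if "E \<in> \<E>" for E
    using z[OF that] by (simp flip: complex_norm_square)
  then have "proj_comb n \<E> z \<in> carrier (unitary_group n)"
    unfolding carrier_unitary_group_iff adjoint_proj_comb[OF S]
    by (auto intro!: inv simp: mult.commute)
  then show ?thesis using proj_comb_mult[OF S] by (auto simp: proj_torus_def)
qed

text \<open>\<open>M\<close> preserves the Frobenius norm and \<open>frob E\<close> is nonzero, so
  each block scalar has modulus 1 and is \<open>cis\<close> of its argument.\<close>

lemma proj_torus_eq_proj_comb:
  assumes S: "proj_system n \<E>" and M: "M \<in> proj_torus n \<E>"
  obtains \<theta> where "M = proj_comb n \<E> (\<lambda>E. cis (\<theta> E))"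
proof -
  have Mc: "M \<in> carrier (unitary_group n)" "M \<in> carrier_mat n n"
    using M by (auto dest: proj_torus_carrier)
  have "\<forall>E\<in>\<E>. \<exists>t. M * E = cis t \<cdot>\<^sub>m E"
  proof
    fix E assume E: "E \<in> \<E>"
    obtain z where z: "M * E = z \<cdot>\<^sub>m E" using proj_torusE[OF M E] .
    have "cmod z * frob E = frob E"
      using frob_unitary_mult[OF Mc(1) proj_systemD(2)[OF S E]] z by (simp add: frob_smult)
    then have "cmod z = 1" using mtrace_proj(2)[OF S E] by auto
    moreover from this have "z \<noteq> 0" by auto
    ultimately have "z = cis (Arg z)" using cis_Arg[of z] by (simp add: sgn_eq)
    with z show "\<exists>t. M * E = cis t \<cdot>\<^sub>m E" by metis
  qed
  then obtain \<theta> where \<theta>: "\<And>E. E \<in> \<E> \<Longrightarrow> M * E = cis (\<theta> E) \<cdot>\<^sub>m E" by metis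
  have "M = proj_comb n \<E> (\<lambda>E. cis (\<theta> E))"
    by (rule proj_system_ext[OF S]) (use Mc \<theta> proj_comb_mult[OF S] in auto)
  with that show ?thesis by blast
qed

text \<open>Multiplying all angles by a real \<open>t\<close> gives a continuous curve through a
  given element at \<open>t = 1\<close> and through the identity at \<open>t = 0\<close>. The torus
  is the union of these curves, which are connected and share a point.\<close>

lemma connectedin_proj_torus:
  assumes S: "proj_system n \<E>"
  shows "connectedin (mat_topology n) (proj_torus n \<E>)"
proof -
  define path where "path \<theta> t = proj_comb n \<E> (\<lambda>E. cis (t * \<theta> E))" for \<theta> :: "complex mat \<Rightarrow> real" and t
  have cont: "continuous_map euclideanreal (mat_topology n) (path \<theta>)" for \<theta>
    unfolding mat_topology_def
  proof (rule continuous_map_pullback')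
    show "continuous_map euclideanreal (product_topology (\<lambda>_. euclidean) ({..<n} \<times> {..<n}))
        ((\<lambda>M. restrict (\<lambda>ij. M $$ ij) ({..<n} \<times> {..<n})) \<circ> path \<theta>)"
      unfolding continuous_map_componentwise
      by (auto simp: path_def proj_comb_def intro!: continuous_intros)
    show "topspace euclideanreal \<subseteq> path \<theta> -` carrier_mat n n" by (auto simp: path_def)
  qed
  have "connectedin (mat_topology n) (path \<theta> ` UNIV)" for \<theta>
    by (rule connectedin_continuous_map_image[OF cont]) simp
  then have "connectedin (mat_topology n) (\<Union>(range (\<lambda>\<theta>. path \<theta> ` UNIV)))"
  proof (intro connectedin_Union)
    have "path \<theta> 0 = proj_comb n \<E> (\<lambda>E. 1)" for \<theta> by (simp add: path_def)
    then have "proj_comb n \<E> (\<lambda>E. 1) \<in> path \<theta> ` UNIV" for \<theta> by (metis rangeI)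
    then show "\<Inter>(range (\<lambda>\<theta>. path \<theta> ` UNIV)) \<noteq> {}" by blast
  qed auto
  moreover have "\<Union>(range (\<lambda>\<theta>. path \<theta> ` UNIV)) = proj_torus n \<E>"
  proof
    show "\<Union>(range (\<lambda>\<theta>. path \<theta> ` UNIV)) \<subseteq> proj_torus n \<E>"
      by (auto simp: path_def intro!: proj_comb_mem_torus[OF S])
    show "proj_torus n \<E> \<subseteq> \<Union>(range (\<lambda>\<theta>. path \<theta> ` UNIV))"
    proof
      fix M assume "M \<in> proj_torus n \<E>"
      then obtain \<theta> where "M = proj_comb n \<E> (\<lambda>E. cis (\<theta> E))"
        using proj_torus_eq_proj_comb[OF S] by blast
      then have "M = path \<theta> 1" by (simp add: path_def)
      then show "M \<in> \<Union>(range (\<lambda>\<theta>. path \<theta> ` UNIV))" by blast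
    qed
  qed
  ultimately show ?thesis by simp
qed

section \<open>Splitting a projection\<close>

text \<open>The polynomial with roots \<open>es\<close>, evaluated at \<open>g\<close> and applied
  to \<open>X\<close>. Keeping the roots as a list gives direct access to shortest annihilators and
  repeated roots.\<close>

primrec lin_factors :: "complex mat \<Rightarrow> complex list \<Rightarrow> complex mat \<Rightarrow> complex mat" where
  "lin_factors g [] X = X"
| "lin_factors g (e # es) X = g * lin_factors g es X - e \<cdot>\<^sub>m lin_factors g es X"

lemma lin_factors_carrier [simp]:
  "g \<in> carrier_mat n n \<Longrightarrow> X \<in> carrier_mat n n \<Longrightarrow> lin_factors g es X \<in> carrier_mat n n"
  by (induction es) auto

lemma lin_factors_append: "lin_factors g (es @ fs) X = lin_factors g es (lin_factors g fs X)"
  by (induction es) auto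

lemma lin_factors_mult:
  assumes "g \<in> carrier_mat n n" "X \<in> carrier_mat n n" "Y \<in> carrier_mat n n"
  shows "lin_factors g es (X * Y) = lin_factors g es X * Y"
  using assms by (induction es)
    (auto simp: minus_mult_distrib_mat[of _ n n _ _ n] mult_smult_assoc_mat[of _ n n _ n]
      assoc_mult_mat[of _ n n _ n _ n])

text \<open>The intertwining form covers two uses: \<open>Z\<close> a change of basis, in the
  triangularisation, and \<open>h = g\<close>, for matrices that commute with
  \<open>g\<close>.\<close>

lemma lin_factors_commute:
  assumes g: "g \<in> carrier_mat n n" and h: "h \<in> carrier_mat n n"
    and X: "X \<in> carrier_mat n n" and Z: "Z \<in> carrier_mat n n" and gZ: "g * Z = Z * h"
  shows "lin_factors g es (Z * X) = Z * lin_factors h es X"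
proof (induction es)
  case (Cons e es)
  define Y where "Y = lin_factors h es X"
  have Y: "Y \<in> carrier_mat n n" using h X by (simp add: Y_def)
  have "g * (Z * Y) = Z * (h * Y)"
    using assoc_mult_mat[OF g Z Y] assoc_mult_mat[OF Z h Y] unfolding gZ by (rule trans[OF sym])
  then show ?case using Cons g h Z Y
    by (simp add: mult_minus_distrib_mat[of _ n n _ n] mult_smult_distrib[of _ n n _ n] flip: Y_def)
qed simp

lemma lin_factors_swap:
  assumes "g \<in> carrier_mat n n" "X \<in> carrier_mat n n"
  shows "lin_factors g (e # f # es) X = lin_factors g (f # e # es) X"
proof -
  define Y where "Y = lin_factors g es X"
  have Y: "Y \<in> carrier_mat n n" using assms by (simp add: Y_def)
  have "lin_factors g (e # f # es) X = g * (g * Y) - f \<cdot>\<^sub>m (g * Y) - e \<cdot>\<^sub>m (g * Y - f \<cdot>\<^sub>m Y)"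
    for e f using assms Y
    by (simp add: mult_minus_distrib_mat[of _ n n _ n] mult_smult_distrib[of _ n n _ n] flip: Y_def)
  moreover have "g * (g * Y) - f \<cdot>\<^sub>m (g * Y) - e \<cdot>\<^sub>m (g * Y - f \<cdot>\<^sub>m Y) =
      g * (g * Y) - e \<cdot>\<^sub>m (g * Y) - f \<cdot>\<^sub>m (g * Y - e \<cdot>\<^sub>m Y)"
    using assms Y by (intro eq_matI) (auto simp: algebra_simps simp del: index_mult_mat(1))
  ultimately show ?thesis by simp
qed

lemma lin_factors_move:
  assumes "g \<in> carrier_mat n n" "X \<in> carrier_mat n n"
  shows "lin_factors g (es @ e # fs) X = lin_factors g (e # es @ fs) X"
proof (induction es)
  case (Cons f es)
  then have "lin_factors g (f # es @ e # fs) X = lin_factors g (f # e # es @ fs) X" by simp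
  also have "\<dots> = lin_factors g (e # f # es @ fs) X" using assms by (rule lin_factors_swap)
  finally show ?case by simp
qed simp

lemma lin_factors_eigen:
  assumes "g \<in> carrier_mat n n" "X \<in> carrier_mat n n" "g * X = l \<cdot>\<^sub>m X"
  shows "lin_factors g es X = (\<Prod>e\<leftarrow>es. l - e) \<cdot>\<^sub>m X"
proof (induction es)
  case Nil
  show ?case by (rule eq_matI) auto
next
  case (Cons e es)
  then show ?case using assms
    by (auto simp: mult_smult_distrib[of _ n n _ n] smult_smult algebra_simps intro!: eq_matI)
qed

text \<open>\<open>k\<close> bounds the rows of \<open>X\<close> that may be nonzero. If the rows
  after \<open>k\<close> vanish, then by triangularity row \<open>k\<close> of \<open>B * X\<close>
  is the diagonal entry of \<open>B\<close> at \<open>k\<close> times row \<open>k\<close> of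
  \<open>X\<close>, and the later rows stay zero. Subtracting that multiple of \<open>X\<close>
  clears row \<open>k\<close> as well.\<close>

lemma upper_triangular_annihilated:
  assumes B: "B \<in> carrier_mat n n" "upper_triangular B"
    and "X \<in> carrier_mat n n" "k \<le> n" "\<And>i j. i < n \<Longrightarrow> j < n \<Longrightarrow> k \<le> i \<Longrightarrow> X $$ (i, j) = 0"
  shows "\<exists>es. lin_factors B es X = 0\<^sub>m n n"
  using assms(3-)
proof (induction k arbitrary: X)
  case 0
  then have "lin_factors B [] X = 0\<^sub>m n n" by (intro eq_matI) auto
  then show ?case ..
next
  case (Suc k)
  define Y where "Y = lin_factors B [B $$ (k, k)] X"
  have Y: "Y \<in> carrier_mat n n" using B Suc by (simp add: Y_def)
  have "Y $$ (i, j) = 0" if ij: "i < n" "j < n" "k \<le> i" for i j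
  proof -
    have "(\<Sum>l<n. B $$ (i, l) * X $$ (l, j)) = (\<Sum>l<n. if l = k then B $$ (i, k) * X $$ (k, j) else 0)"
    proof (rule sum.cong)
      fix l assume l: "l \<in> {..<n}"
      consider "l < k" | "l = k" | "l > k" by linarith
      then show "B $$ (i, l) * X $$ (l, j) = (if l = k then B $$ (i, k) * X $$ (k, j) else 0)"
      proof cases
        case 1
        then have "B $$ (i, l) = 0" using B ij unfolding upper_triangular_def by auto
        with 1 show ?thesis by simp
      next
        case 3
        then show ?thesis using Suc.prems(3)[of l j] l ij by simp
      qed simp
    qed simp
    also have "\<dots> = B $$ (i, k) * X $$ (k, j)" using Suc.prems by simp
    also have "\<dots> = B $$ (k, k) * X $$ (i, j)"
    proof (cases "i = k")
      case False
      then have "B $$ (i, k) = 0" using B ij unfolding upper_triangular_def by auto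
      with False show ?thesis using Suc.prems(3)[of i j] ij by simp
    qed simp
    finally have "(B * X) $$ (i, j) = B $$ (k, k) * X $$ (i, j)"
      using mat_mult_index[OF B(1) Suc.prems(1) ij(1,2)] by simp
    then show ?thesis using B Suc.prems(1) ij by (simp add: Y_def del: index_mult_mat(1))
  qed
  then obtain es where "lin_factors B es Y = 0\<^sub>m n n"
    using Suc.IH[OF Y] Suc.prems(2) by auto
  then have "lin_factors B (es @ [B $$ (k, k)]) X = 0\<^sub>m n n" by (simp only: lin_factors_append Y_def)
  then show ?case ..
qed

text \<open>A Schur form \<open>g = P * B * Q\<close> reduces this to a triangular matrix acting on
  \<open>Q * X\<close>, and \<open>g * P = P * B\<close> carries the product of factors
  back.\<close>

lemma lin_factors_annihilate:
  assumes g: "g \<in> carrier_mat n n" and X: "X \<in> carrier_mat n n"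
  shows "\<exists>es. lin_factors g es X = 0\<^sub>m n n"
proof -
  obtain as where "char_poly g = (\<Prod>a\<leftarrow>as. [:- a, 1:])"
    using char_poly_factorized[OF g] by auto
  then obtain B where B: "B \<in> carrier_mat n n" "upper_triangular B" "similar_mat g B"
    using schur_decomposition_exists[OF g] by blast
  then obtain m P Q where PQ: "{g, B, P, Q} \<subseteq> carrier_mat m m" "P * Q = 1\<^sub>m m" "Q * P = 1\<^sub>m m" "g = P * B * Q"
    using similar_matD[OF B(3)] by blast
  have "m = n" using PQ(1) g by auto
  with PQ have P: "P \<in> carrier_mat n n" "Q \<in> carrier_mat n n" "P * Q = 1\<^sub>m n" "Q * P = 1\<^sub>m n" by auto
  have gP: "g * P = P * B"
    using P B(1) PQ(4) by (simp add: assoc_mult_mat[of _ n n _ n _ n])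
  obtain es where es: "lin_factors B es (Q * X) = 0\<^sub>m n n"
    using upper_triangular_annihilated[OF B(1,2), of "Q * X" n] P X by auto
  have "P * (Q * X) = X" using assoc_mult_mat[OF P(1,2) X] P X by simp
  then have "lin_factors g es X = P * lin_factors B es (Q * X)"
    using lin_factors_commute[OF g B(1) _ P(1) gP, of "Q * X" es] P X by simp
  then have "lin_factors g es X = 0\<^sub>m n n" using es P by simp
  then show ?thesis ..
qed

text \<open>An eigenvector \<open>Y = g X - l X\<close> of the unitary matrix \<open>g\<close> is also an eigenvector of the
  adjoint of \<open>g\<close>, which makes it orthogonal to the range of \<open>g - l\<close>, hence to itself.\<close>

lemma unitary_no_jordan_block:
  assumes g: "g \<in> carrier (unitary_group n)" and X: "X \<in> carrier_mat n n"
    and "lin_factors g [l, l] X = 0\<^sub>m n n"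
  shows "lin_factors g [l] X = 0\<^sub>m n n"
proof (rule ccontr)
  have gc: "g \<in> carrier_mat n n" using g by (simp add: carrier_unitary_group_iff)
  define Y where "Y = g * X - l \<cdot>\<^sub>m X"
  have Y: "Y \<in> carrier_mat n n" using gc X by (simp add: Y_def)
  assume "lin_factors g [l] X \<noteq> 0\<^sub>m n n"
  then have Y0: "Y \<noteq> 0\<^sub>m n n" by (simp add: Y_def)
  have "g * Y - l \<cdot>\<^sub>m Y = 0\<^sub>m n n" using assms(3) by (simp add: Y_def)
  then have gY: "g * Y = l \<cdot>\<^sub>m Y" using gc Y by (rule_tac minus_eq_zeroD) auto
  have "cmod l * frob Y = frob Y" using frob_unitary_mult[OF g Y] by (simp add: gY frob_smult)
  moreover have "frob Y \<noteq> 0" using Y0 frob_eq_0_iff[OF Y] by simp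
  ultimately have "cmod l = 1" by simp
  then have ll: "cnj l * l = 1" by (simp add: mult.commute flip: complex_norm_square)
  have "Y = l \<cdot>\<^sub>m (mat_adjoint g * Y)"
    using unitary_cancel_left(1)[OF g Y] gc Y by (simp add: gY mult_smult_distrib[of _ n n _ n])
  from arg_cong[OF this, of "\<lambda>M. cnj l \<cdot>\<^sub>m M"]
  have "cnj l \<cdot>\<^sub>m Y = (cnj l * l) \<cdot>\<^sub>m (mat_adjoint g * Y)"
    unfolding smult_smult .
  then have "mat_adjoint g * Y = cnj l \<cdot>\<^sub>m Y" by (simp add: ll one_smult)
  then have "mat_adjoint (mat_adjoint g * Y) = mat_adjoint (cnj l \<cdot>\<^sub>m Y)" by simp
  then have Yg: "mat_adjoint Y * g = l \<cdot>\<^sub>m mat_adjoint Y"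
    using gc Y by (simp add: mat_adjoint_mult[of _ n n _ n] mat_adjoint_mat_adjoint adjoint_smult)
  have "mat_adjoint Y * Y = mat_adjoint Y * g * X - l \<cdot>\<^sub>m (mat_adjoint Y * X)"
    using gc X Y
    by (subst (2) Y_def) (simp add: mult_minus_distrib_mat[of _ n n _ n] mult_smult_distrib[of _ n n _ n]
        assoc_mult_mat[of _ n n _ n _ n])
  also have "\<dots> = 0\<^sub>m n n"
    using X Y by (simp add: Yg mult_smult_assoc_mat[of _ n n _ n])
  finally have "complex_of_real ((frob Y)\<^sup>2) = mtrace (0\<^sub>m n n)"
    using mtrace_adjoint_mult[OF Y] by simp
  then have "frob Y = 0" by (simp add: mtrace_def)
  with \<open>frob Y \<noteq> 0\<close> show False ..
qed

text \<open>By normality, multiplying \<open>Y\<close> by \<open>F\<close> or by its adjoint gives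
  matrices of equal norm. For \<open>Y = 1 - F\<close> the first product is 0, hence so is the
  second; thus the adjoint of \<open>F\<close> equals the adjoint times \<open>F\<close>, a
  self-adjoint matrix.\<close>

lemma normal_idempotent_selfadjoint:
  fixes F :: "complex mat"
  assumes F: "F \<in> carrier_mat n n" and normal: "mat_adjoint F * F = F * mat_adjoint F" and idem: "F * F = F"
  shows "mat_adjoint F = F"
proof -
  have aF: "mat_adjoint F \<in> carrier_mat n n" using F by simp
  define Y where "Y = 1\<^sub>m n - F"
  have Y: "Y \<in> carrier_mat n n" using F by (simp add: Y_def)
  have FY: "F * Y = 0\<^sub>m n n" using F idem by (simp add: Y_def mult_minus_distrib_mat[of _ n n _ n])
  have "mat_adjoint F * (F * Y) = F * (mat_adjoint F * Y)"
    using assoc_mult_mat[OF aF F Y] assoc_mult_mat[OF F aF Y] unfolding normal by (rule trans[OF sym])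
  then have "mat_adjoint (mat_adjoint F * Y) * (mat_adjoint F * Y) = mat_adjoint (F * Y) * (F * Y)"
    using F aF Y
    by (simp add: mat_adjoint_mult[of _ n n _ n] mat_adjoint_mat_adjoint assoc_mult_mat[of _ n n _ n _ n])
  then have "frob (mat_adjoint F * Y) = frob (F * Y)"
    using F aF Y by (intro frob_eqI[of _ n]) auto
  also have "\<dots> = 0" using FY frob_eq_0_iff[of "F * Y" n n] F Y by simp
  finally have "mat_adjoint F * Y = 0\<^sub>m n n" using frob_eq_0_iff[of "mat_adjoint F * Y" n n] aF Y by simp
  then have "mat_adjoint F - mat_adjoint F * F = 0\<^sub>m n n"
    using F aF by (simp add: Y_def mult_minus_distrib_mat[of _ n n _ n])
  then have 1: "mat_adjoint F = mat_adjoint F * F" using F aF by (rule_tac minus_eq_zeroD) auto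
  then have "mat_adjoint (mat_adjoint F) = mat_adjoint (mat_adjoint F * F)" by simp
  then have "F = mat_adjoint F * F" using F aF by (simp add: mat_adjoint_mult[of _ n n _ n] mat_adjoint_mat_adjoint)
  with 1 show ?thesis by simp
qed

text \<open>Some \<open>E\<close> is split into \<open>F\<close> and \<open>E - F\<close>, where
  \<open>F\<close> projects onto one eigenspace of \<open>g\<close> inside the range of
  \<open>E\<close>. As a polynomial in \<open>g\<close> times \<open>E\<close>, it commutes with
  everything that commutes with \<open>g\<close> and \<open>E\<close>. This yields both the
  inclusion of the centralizer and the normality of \<open>F\<close>.\<close>

lemma exists_proj_refinement:
  assumes S: "proj_system n \<E>" and g: "g \<in> commutant n \<E>" "g \<notin> proj_torus n \<E>"
  obtains \<E>' where "proj_system n \<E>'" "card \<E>' = Suc (card \<E>)"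
    "{x \<in> commutant n \<E>. x * g = g * x} \<subseteq> commutant n \<E>'"
proof -
  have gU: "g \<in> carrier (unitary_group n)" using g(1) by (simp add: commutant_def)
  then have gc: "g \<in> carrier_mat n n" by (simp add: carrier_unitary_group_iff)
  obtain E where E: "E \<in> \<E>" and nscal: "\<And>z. g * E \<noteq> z \<cdot>\<^sub>m E"
    using g(2) gU unfolding proj_torus_def by blast
  note Ed = proj_systemD(2-5)[OF S E]
  have gE: "g * E = E * g" using g(1) E by (auto simp: commutant_def)
  \<comment> \<open>The roots of the minimal polynomial of \<open>g\<close> on the range of
    \<open>E\<close>. Omitting the first root \<open>l\<close> leaves a nonzero product
    \<open>F0\<close>, which the remaining factor \<open>g - l\<close> annihilates.\<close>
  define es where "es = arg_min length (\<lambda>es. lin_factors g es E = 0\<^sub>m n n)"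
  have es: "lin_factors g es E = 0\<^sub>m n n"
    and min: "\<And>fs. lin_factors g fs E = 0\<^sub>m n n \<Longrightarrow> length es \<le> length fs"
    using lin_factors_annihilate[OF gc Ed(1)] unfolding es_def
    by (auto intro: arg_min_natI arg_min_nat_le)
  obtain l q where lq: "es = l # q" using es Ed(4) by (cases es) auto
  define F0 where "F0 = lin_factors g q E"
  have F0: "F0 \<in> carrier_mat n n" using gc Ed by (simp add: F0_def)
  have F0nz: "F0 \<noteq> 0\<^sub>m n n" using min[of q] lq by (auto simp: F0_def)
  have gF0: "g * F0 = l \<cdot>\<^sub>m F0"
    using es gc F0 by (rule_tac minus_eq_zeroD) (auto simp: lq F0_def)
  \<comment> \<open>If \<open>l\<close> occurred again in \<open>q\<close>, both copies could be
    moved to the front, and \<open>unitary_no_jordan_block\<close> would drop one of them,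
    contradicting minimal length.\<close>
  have lnq: "l \<notin> set q"
  proof
    assume "l \<in> set q"
    then obtain xs ys where q: "q = xs @ l # ys" by (meson split_list)
    have "lin_factors g (l # l # xs @ ys) E = 0\<^sub>m n n"
      using es lin_factors_move[OF gc Ed(1), of xs l ys] by (simp add: lq q)
    then have "lin_factors g [l, l] (lin_factors g (xs @ ys) E) = 0\<^sub>m n n" by simp
    then have "lin_factors g [l] (lin_factors g (xs @ ys) E) = 0\<^sub>m n n"
      using gU gc Ed by (intro unitary_no_jordan_block) auto
    then have "lin_factors g (l # xs @ ys) E = 0\<^sub>m n n" by simp
    from min[OF this] show False by (simp add: lq q)
  qed
  \<comment> \<open>The scalar by which the product over \<open>q\<close> acts on the eigenvectors
    in \<open>F0\<close>. Hence \<open>F0 * F0\<close> is \<open>c\<close> times \<open>F0\<close>,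
    and division by \<open>c\<close> produces an idempotent.\<close>
  define c where "c = (\<Prod>e\<leftarrow>q. l - e)"
  have c: "c \<noteq> 0" using lnq by (auto simp: c_def prod_list_zero_iff)
  have F0E: "F0 * E = F0" using lin_factors_mult[OF gc Ed(1,1), of q] Ed by (simp add: F0_def)
  have comm0: "Z * F0 = F0 * Z" if Z: "Z \<in> carrier_mat n n" "Z * g = g * Z" "Z * E = E * Z" for Z
    using lin_factors_commute[OF gc gc Ed(1) Z(1), of q] lin_factors_mult[OF gc Ed(1) Z(1), of q] Z
    by (simp add: F0_def)
  have EF0: "E * F0 = F0" using comm0[of E] F0E gE Ed by simp
  have F0F0: "F0 * F0 = c \<cdot>\<^sub>m F0"
    using lin_factors_mult[OF gc Ed(1) F0, of q] lin_factors_eigen[OF gc F0 gF0, of q]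
    by (simp add: EF0 c_def flip: F0_def)
  define F where "F = (1 / c) \<cdot>\<^sub>m F0"
  have F: "F \<in> carrier_mat n n" using F0 by (simp add: F_def)
  have F0F: "F0 = c \<cdot>\<^sub>m F" using c by (auto simp: F_def smult_smult intro!: eq_matI)
  have Fnz: "F \<noteq> 0\<^sub>m n n"
  proof
    assume "F = 0\<^sub>m n n"
    then have "F0 = 0\<^sub>m n n" unfolding F0F by (auto intro!: eq_matI)
    with F0nz show False ..
  qed
  have FF: "F * F = F"
    using F0 F0F0 c by (auto simp: F_def mult_smult_distrib[of _ n n _ n] mult_smult_assoc_mat[of _ n n _ n]
        smult_smult)
  have FE: "F * E = F" "E * F = F" using F0 Ed F0E EF0
    by (auto simp: F_def mult_smult_distrib[of _ n n _ n] mult_smult_assoc_mat[of _ n n _ n])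
  have gF: "g * F = l \<cdot>\<^sub>m F"
    using gc F0 gF0 by (auto simp: F_def mult_smult_distrib[of _ n n _ n] smult_smult mult.commute)
  have comm: "Z * F = F * Z" if "Z \<in> carrier_mat n n" "Z * g = g * Z" "Z * E = E * Z" for Z
    using comm0[OF that] F0 that(1)
    by (simp add: F_def mult_smult_distrib[of _ n n _ n] mult_smult_assoc_mat[of _ n n _ n])
  \<comment> \<open>\<open>comm\<close> is applied twice: first to the adjoint of \<open>g\<close>,
    and, after taking adjoints, to the adjoint of \<open>F\<close>. The second application is
    normality.\<close>
  have aF: "mat_adjoint F = F"
  proof (rule normal_idempotent_selfadjoint[OF F _ FF])
    have ag: "mat_adjoint g \<in> carrier_mat n n" using gc by simp
    have agE: "mat_adjoint g * E = E * mat_adjoint g"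
      using arg_cong[OF gE, of mat_adjoint] gc Ed by (simp add: mat_adjoint_mult[of _ n n _ n])
    have "mat_adjoint g * F = F * mat_adjoint g"
      using gU ag agE by (intro comm) (auto simp: carrier_unitary_group_iff)
    from arg_cong[OF this, of mat_adjoint] have "mat_adjoint F * g = g * mat_adjoint F"
      using gc F ag by (simp add: mat_adjoint_mult[of _ n n _ n] mat_adjoint_mat_adjoint)
    moreover have "mat_adjoint F * E = E * mat_adjoint F"
    proof -
      have "mat_adjoint (E * F) = mat_adjoint (F * E)" using FE by simp
      then show ?thesis using F Ed by (simp add: mat_adjoint_mult[of _ n n _ n])
    qed
    ultimately show "mat_adjoint F * F = F * mat_adjoint F"
      using F by (intro comm) auto
  qed
  define F' where "F' = E - F"
  have F': "F' \<in> carrier_mat n n" using F by (simp add: F'_def)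
  \<comment> \<open>If \<open>F'\<close> were 0, then \<open>g\<close> would act on \<open>E\<close>
    as the scalar \<open>l\<close>, against the choice of \<open>E\<close>.\<close>
  have F'nz: "F' \<noteq> 0\<^sub>m n n"
  proof
    assume "F' = 0\<^sub>m n n"
    then have "E = F" using Ed F by (rule_tac minus_eq_zeroD) (auto simp: F'_def)
    then show False using nscal gF by auto
  qed
  have F'F: "F' * F = 0\<^sub>m n n" "F * F' = 0\<^sub>m n n"
    using F Ed FF FE by (simp_all add: F'_def minus_mult_distrib_mat[of _ n n _ _ n] mult_minus_distrib_mat[of _ n n _ n])
  have F'F': "F' * F' = F'"
  proof -
    have "F' * F' = E * F' - F * F'" using F Ed F' by (subst F'_def) (simp add: minus_mult_distrib_mat[of _ n n _ _ n])
    also have "E * F' = F'" using F Ed FE by (simp add: F'_def mult_minus_distrib_mat[of _ n n _ n])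
    finally show ?thesis using F'F F' by (auto intro!: eq_matI)
  qed
  have aF': "mat_adjoint F' = F'" using F Ed aF by (simp add: F'_def adjoint_minus[of _ n n])
  have orth: "F * G = 0\<^sub>m n n" "G * F = 0\<^sub>m n n" "F' * G = 0\<^sub>m n n" "G * F' = 0\<^sub>m n n"
    if G: "G \<in> \<E> - {E}" for G
  proof -
    have Gc: "G \<in> carrier_mat n n" and EG: "E * G = 0\<^sub>m n n" "G * E = 0\<^sub>m n n"
      using G E proj_systemD(2)[OF S] proj_systemD(6)[OF S, of E G] proj_systemD(6)[OF S, of G E] by auto
    have "F * G = F * (E * G)" using assoc_mult_mat[OF F Ed(1) Gc] FE by simp
    then show 1: "F * G = 0\<^sub>m n n" using EG F by simp
    have "G * F = G * (E * F)" using FE by simp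
    also have "\<dots> = G * E * F" using F Ed Gc by simp
    finally show 2: "G * F = 0\<^sub>m n n" using EG F by simp
    show "F' * G = 0\<^sub>m n n" "G * F' = 0\<^sub>m n n" using 1 2 EG F Ed Gc
      by (simp_all add: F'_def minus_mult_distrib_mat[of _ n n _ _ n] mult_minus_distrib_mat[of _ n n _ n])
  qed
  define \<E>' where "\<E>' = insert F (insert F' (\<E> - {E}))"
  have FF': "F \<noteq> F'" using F'F FF Fnz by auto
  \<comment> \<open>A member of \<open>\<E> - {E}\<close> is orthogonal to \<open>F\<close>, so
    \<open>F\<close> among them would have square 0 although it is a nonzero idempotent.\<close>
  have Fn: "F \<notin> \<E> - {E}" using orth(1)[of F] FF Fnz by auto
  have F'n: "F' \<notin> \<E> - {E}" using orth(3)[of F'] F'F' F'nz by auto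
  have fin: "finite \<E>" using proj_systemD(1)[OF S] .
  have "proj_system n \<E>'"
    unfolding proj_system_def
  proof (intro conjI)
    show "finite \<E>'" using fin by (simp add: \<E>'_def)
    show "\<forall>E\<in>\<E>'. E \<in> carrier_mat n n \<and> mat_adjoint E = E \<and> E * E = E \<and> E \<noteq> 0\<^sub>m n n"
      using F F' aF aF' FF F'F' Fnz F'nz proj_systemD(2-5)[OF S] by (simp add: \<E>'_def)
    show "\<forall>E\<in>\<E>'. \<forall>F\<in>\<E>'. E \<noteq> F \<longrightarrow> E * F = 0\<^sub>m n n"
      using F'F orth proj_systemD(6)[OF S] by (simp add: \<E>'_def)
    show "\<forall>i<n. \<forall>j<n. (\<Sum>E\<in>\<E>'. E $$ (i, j)) = 1\<^sub>m n $$ (i, j)"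
    proof (intro allI impI)
      fix i j assume ij: "i < n" "j < n"
      have "(\<Sum>E\<in>\<E>'. E $$ (i, j)) = F $$ (i, j) + (F' $$ (i, j) + (\<Sum>G\<in>\<E> - {E}. G $$ (i, j)))"
        using fin Fn F'n FF' by (simp add: \<E>'_def)
      also have "\<dots> = E $$ (i, j) + (\<Sum>G\<in>\<E> - {E}. G $$ (i, j))"
        using ij F Ed by (simp add: F'_def)
      also have "\<dots> = (\<Sum>G\<in>\<E>. G $$ (i, j))" using fin E by (simp add: sum.remove)
      also have "\<dots> = 1\<^sub>m n $$ (i, j)" using proj_systemD(7)[OF S ij] .
      finally show "(\<Sum>E\<in>\<E>'. E $$ (i, j)) = 1\<^sub>m n $$ (i, j)" .
    qed
  qed
  moreover have "card \<E>' = Suc (card \<E>)"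
    using fin Fn F'n FF' card.remove[OF fin E] by (simp add: \<E>'_def)
  moreover have "{x \<in> commutant n \<E>. x * g = g * x} \<subseteq> commutant n \<E>'"
  proof clarify
    fix x assume x: "x \<in> commutant n \<E>" "x * g = g * x"
    then have xU: "x \<in> carrier (unitary_group n)" "x \<in> carrier_mat n n" "\<And>G. G \<in> \<E> \<Longrightarrow> x * G = G * x"
      unfolding commutant_def carrier_unitary_group_iff by blast+
    have xF: "x * F = F * x" using xU x E by (intro comm) auto
    have "x * F' = F' * x" using xF xU E F Ed xU(3)[OF E]
      by (simp add: F'_def minus_mult_distrib_mat[of _ n n _ _ n] mult_minus_distrib_mat[of _ n n _ n])
    with xF xU show "x \<in> commutant n \<E>'" by (auto simp: commutant_def \<E>'_def)
  qed
  ultimately show ?thesis using that by blast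
qed

section \<open>Descent through centralizers\<close>

lemma cmod_unitary_entry_le:
  assumes M: "M \<in> carrier (unitary_group n)" and ij: "i < n" "j < n"
  shows "cmod (M $$ (i, j)) \<le> 1"
proof -
  have Mc: "M \<in> carrier_mat n n" "mat_adjoint M * M = 1\<^sub>m n"
    using M by (auto simp: carrier_unitary_group_iff)
  have "(mat_adjoint M * M) $$ (j, j) = (\<Sum>k<n. cnj (M $$ (k, j)) * M $$ (k, j))"
    using Mc(1) ij by (subst mat_mult_index[of _ n n _ n]) (auto simp: index_mat_adjoint)
  also have "\<dots> = (\<Sum>k<n. of_real ((cmod (M $$ (k, j)))\<^sup>2))"
    unfolding complex_norm_square by (simp add: mult.commute)
  finally have "complex_of_real (\<Sum>k<n. (cmod (M $$ (k, j)))\<^sup>2) = of_real 1"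
    using Mc ij by simp
  then have "(\<Sum>k<n. (cmod (M $$ (k, j)))\<^sup>2) = 1" by (simp only: of_real_eq_iff)
  moreover have "(cmod (M $$ (i, j)))\<^sup>2 \<le> (\<Sum>k<n. (cmod (M $$ (k, j)))\<^sup>2)"
    using ij by (intro member_le_sum) auto
  ultimately have "(cmod (M $$ (i, j)))\<^sup>2 \<le> 1\<^sup>2" by simp
  then show ?thesis by (rule power2_le_imp_le) simp
qed

text \<open>Rounds each of the \<open>2 * n\<^sup>2\<close> real coordinates down to a multiple of
  \<open>1 / m\<close>. Outside the range of indices \<open>restrict\<close> fixes the value, so
  that only finitely many cells meet the unitary group.\<close>

definition grid_cell :: "nat \<Rightarrow> nat \<Rightarrow> complex mat \<Rightarrow> nat \<times> nat \<Rightarrow> int \<times> int" where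
  "grid_cell n m M = restrict (\<lambda>ij. (\<lfloor>m * Re (M $$ ij)\<rfloor>, \<lfloor>m * Im (M $$ ij)\<rfloor>)) ({..<n} \<times> {..<n})"

lemma card_grid_cells_le:
  assumes D: "D \<subseteq> carrier (unitary_group n)"
  shows "card (grid_cell n m ` D) \<le> (2 * m + 1) ^ (2 * n\<^sup>2)"
proof -
  let ?P = "PiE ({..<n} \<times> {..<n}) (\<lambda>_. {- int m..int m} \<times> {- int m..int m})"
  have fl: "\<lfloor>real m * x\<rfloor> \<in> {- int m..int m}" if "\<bar>x\<bar> \<le> 1" for x
  proof -
    have "\<bar>real m * x\<bar> \<le> real m" using that by (simp add: abs_mult mult_left_le)
    then have "- real m \<le> real m * x" "real m * x \<le> real m" by linarith+
    then show ?thesis by (simp add: le_floor_iff floor_le_iff)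
  qed
  have "grid_cell n m ` D \<subseteq> ?P"
  proof (rule image_subsetI)
    fix M assume "M \<in> D"
    then have M: "cmod (M $$ (i, j)) \<le> 1" if "i < n" "j < n" for i j
      using cmod_unitary_entry_le[of M n i j] D that by auto
    have "\<bar>Re (M $$ (i, j))\<bar> \<le> 1" "\<bar>Im (M $$ (i, j))\<bar> \<le> 1" if "i < n" "j < n" for i j
      using M[OF that] abs_Re_le_cmod[of "M $$ (i, j)"] abs_Im_le_cmod[of "M $$ (i, j)"] by linarith+
    then show "grid_cell n m M \<in> ?P"
      unfolding grid_cell_def using fl by (auto simp del: atLeastAtMost_iff)
  qed
  then have "card (grid_cell n m ` D) \<le> card ?P"
    by (intro card_mono finite_PiE) auto
  also have "\<dots> = (2 * m + 1) ^ (2 * n\<^sup>2)"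
  proof -
    have "nat (1 + int m + int m) = 2 * m + 1" by simp
    then have "card ({- int m..int m} \<times> {- int m..int m}) = (2 * m + 1)\<^sup>2"
      by (simp add: card_cartesian_product power2_eq_square)
    then show ?thesis
      by (simp add: card_PiE card_cartesian_product power2_eq_square[of n] flip: power_mult)
  qed
  finally show ?thesis .
qed

text \<open>At mesh \<open>1 / (8 * n)\<close> each of the \<open>n\<^sup>2\<close> entries
  contributes at most \<open>2 / (64 * n\<^sup>2)\<close> to the squared distance, in total 1/32,
  which is below 1/25.\<close>

lemma frob_diff_same_cell:
  assumes M: "M \<in> carrier_mat n n" and N: "N \<in> carrier_mat n n"
    and n: "n \<ge> 1" and eq: "grid_cell n (8 * n) M = grid_cell n (8 * n) N"
  shows "frob (M - N) \<le> 1 / 5"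
proof -
  have fl: "\<bar>x - y\<bar> \<le> 1 / (8 * real n)" if "\<lfloor>8 * real n * x\<rfloor> = \<lfloor>8 * real n * y\<rfloor>" for x y
  proof -
    have "\<bar>8 * real n * x - 8 * real n * y\<bar> \<le> 1" using that by linarith
    then have "8 * real n * \<bar>x - y\<bar> \<le> 1"
      using abs_mult[of "8 * real n" "x - y"] by (simp add: algebra_simps)
    then show ?thesis using n by (simp add: field_simps)
  qed
  have entry: "(cmod ((M - N) $$ (i, j)))\<^sup>2 \<le> 2 * (1 / (8 * real n))\<^sup>2" if ij: "i < n" "j < n" for i j
  proof -
    have "grid_cell n (8 * n) M (i, j) = grid_cell n (8 * n) N (i, j)" by (simp add: eq)
    then have "\<bar>Re (M $$ (i, j)) - Re (N $$ (i, j))\<bar> \<le> 1 / (8 * real n)"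
      "\<bar>Im (M $$ (i, j)) - Im (N $$ (i, j))\<bar> \<le> 1 / (8 * real n)"
      using ij by (auto simp: grid_cell_def intro!: fl)
    then have "(Re (M $$ (i, j)) - Re (N $$ (i, j)))\<^sup>2 \<le> (1 / (8 * real n))\<^sup>2"
      "(Im (M $$ (i, j)) - Im (N $$ (i, j)))\<^sup>2 \<le> (1 / (8 * real n))\<^sup>2"
      by (auto intro!: power2_le_iff_abs_le[THEN iffD2])
    then show ?thesis using M N ij by (simp add: cmod_power2)
  qed
  have "(frob (M - N))\<^sup>2 = (\<Sum>i<n. \<Sum>j<n. (cmod ((M - N) $$ (i, j)))\<^sup>2)"
    using M N by (intro frob_power2) auto
  also have "\<dots> \<le> (\<Sum>i<n. \<Sum>j<n. 2 * (1 / (8 * real n))\<^sup>2)"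
    by (intro sum_mono entry) auto
  also have "\<dots> = 1 / 32" using n by (simp add: power2_eq_square field_simps)
  also have "\<dots> \<le> (1 / 5)\<^sup>2" by (simp add: power2_eq_square)
  finally show ?thesis by (rule power2_le_imp_le) simp
qed

text \<open>A most populated grid cell lies in the ball about any of its points. The base
  \<open>16 * n + 1\<close> is \<open>2 * m + 1\<close> at \<open>m = 8 * n\<close>.\<close>

lemma exists_dense_ball:
  assumes D: "D \<subseteq> carrier (unitary_group n)" "finite D" "D \<noteq> {}" and n: "n \<ge> 1"
  obtains d where "d \<in> D" "card D \<le> (16 * n + 1) ^ (2 * n\<^sup>2) * card {x \<in> D. frob (x - d) \<le> 1 / 5}"
proof -
  let ?c = "grid_cell n (8 * n)"
  obtain d where d: "d \<in> D" "card D \<le> card (?c ` D) * card {x \<in> D. ?c x = ?c d}"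
    using exists_large_fibre[OF D(2,3), of ?c] by blast
  have c: "x \<in> carrier_mat n n" if "x \<in> D" for x
    using D that by (auto simp: carrier_unitary_group_iff)
  have "card {x \<in> D. ?c x = ?c d} \<le> card {x \<in> D. frob (x - d) \<le> 1 / 5}"
    using D d(1) frob_diff_same_cell[OF c c n] by (intro card_mono) auto
  with card_grid_cells_le[OF D(1), of "8 * n"]
  have "card (?c ` D) * card {x \<in> D. ?c x = ?c d} \<le>
      (16 * n + 1) ^ (2 * n\<^sup>2) * card {x \<in> D. frob (x - d) \<le> 1 / 5}"
    by (intro mult_mono) auto
  with d that show ?thesis by (meson le_trans)
qed

section \<open>Traces on the blocks\<close>

lemma mtrace_smult: "M \<in> carrier_mat n n \<Longrightarrow> mtrace (c \<cdot>\<^sub>m M) = c * mtrace M"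
  by (simp add: mtrace_def sum_distrib_left)

lemma mtrace_minus:
  "M \<in> carrier_mat n n \<Longrightarrow> N \<in> carrier_mat n n \<Longrightarrow> mtrace (M - N) = mtrace M - mtrace N"
  by (simp add: mtrace_def sum_subtractf)

lemma commutant_adjoint:
  assumes S: "proj_system n \<E>" and x: "x \<in> commutant n \<E>"
  shows "mat_adjoint x \<in> commutant n \<E>"
  using subgroup.m_inv_closed[OF subgroup_commutant[OF S] x]
  by (simp add: inv_unitary_group commutant_carrier[OF x])

lemma commutant_mult:
  assumes S: "proj_system n \<E>" and x: "x \<in> commutant n \<E>" and y: "y \<in> commutant n \<E>"
  shows "x * y \<in> commutant n \<E>"
  using subgroup.m_closed[OF subgroup_commutant[OF S] x y] by simp

text \<open>The adjoint of \<open>x\<close> can be moved past \<open>P\<close>, and the trace is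
  cyclic: block traces are invariant under conjugation by the commutant.\<close>

lemma mtrace_conj_mult:
  assumes S: "proj_system n \<E>" and x: "x \<in> commutant n \<E>" and P: "P \<in> \<E>"
    and g: "g \<in> carrier_mat n n"
  shows "mtrace (x * g * mat_adjoint x * P) = mtrace (g * P)"
proof -
  note xc = commutant_carrier[OF x] and Pc = proj_systemD(2)[OF S P]
  have ax: "mat_adjoint x \<in> carrier_mat n n" using xc by simp
  have "mat_adjoint x * P = P * mat_adjoint x"
    using commutant_adjoint[OF S x] P by (simp add: commutant_def)
  then have "x * g * mat_adjoint x * P = x * (g * P * mat_adjoint x)"
    using xc ax Pc g by (simp add: assoc_mult_mat[of _ n n _ n _ n])
  then have "mtrace (x * g * mat_adjoint x * P) = mtrace (g * P * mat_adjoint x * x)"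
    using xc ax Pc g by (simp add: mtrace_mult_commute[of x n] del: assoc_mult_mat)
  also have "g * P * mat_adjoint x * x = g * P * (mat_adjoint x * x)"
    using xc ax Pc g by (intro assoc_mult_mat[of _ n n _ n _ n]) auto
  also have "\<dots> = g * P" using xc Pc g by (simp add: carrier_unitary_group_iff)
  finally show ?thesis .
qed

text \<open>If the trace vanished, that of \<open>(g - 1) * P\<close> would have modulus
  \<open>(frob P)\<^sup>2\<close>. Cauchy-Schwarz bounds it by \<open>frob (g - 1)\<close> times
  \<open>frob P\<close>, less than \<open>frob P\<close>, which contradicts
  \<open>frob P \<ge> 1\<close>.\<close>

lemma mtrace_near_one_neq_0:
  assumes S: "proj_system n \<E>" and P: "P \<in> \<E>" and g: "g \<in> carrier_mat n n"
    and d: "frob (g - 1\<^sub>m n) < 1"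
  shows "mtrace (g * P) \<noteq> 0"
proof
  note Pc = proj_systemD(2)[OF S P]
  assume "mtrace (g * P) = 0"
  then have "mtrace ((g - 1\<^sub>m n) * P) = - of_real ((frob P)\<^sup>2)"
    using g Pc mtrace_proj(1)[OF S P]
    by (simp add: minus_mult_distrib_mat[of _ n n _ _ n] mtrace_minus[of _ n])
  then have "(frob P)\<^sup>2 \<le> frob (g - 1\<^sub>m n) * frob P"
    using cmod_mtrace_mult_le[of "g - 1\<^sub>m n" n P] g Pc by (simp add: norm_power)
  also have "\<dots> < 1 * frob P"
    using d mtrace_proj(2)[OF S P] by (intro mult_strict_right_mono) auto
  also have "\<dots> \<le> frob P * frob P"
    using mtrace_proj(2)[OF S P] by (intro mult_right_mono) auto
  finally show False by (simp add: power2_eq_square)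
qed

text \<open>Comparing traces on every block: a conjugation cannot multiply the nonzero trace of a block
  by a scalar different from 1.\<close>

lemma conj_eq_if_torus:
  assumes S: "proj_system n \<E>" and x: "x \<in> commutant n \<E>" and y: "y \<in> commutant n \<E>"
    and g: "g \<in> carrier (unitary_group n)" "frob (g - 1\<^sub>m n) < 1"
    and T: "mat_adjoint (x * g * mat_adjoint x) * (y * g * mat_adjoint y) \<in> proj_torus n \<E>"
  shows "x * g * mat_adjoint x = y * g * mat_adjoint y"
proof -
  define s t z where "s = x * g * mat_adjoint x" and "t = y * g * mat_adjoint y" and "z = mat_adjoint s * t"
  note xc = commutant_carrier[OF x] and yc = commutant_carrier[OF y]
  have gc: "g \<in> carrier_mat n n" using g by (simp add: carrier_unitary_group_iff)
  interpret group "unitary_group n" by (rule group_unitary_group)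
  have sU: "s \<in> carrier (unitary_group n)" "t \<in> carrier (unitary_group n)"
    using m_closed[OF m_closed[OF xc(1) g(1)] inv_closed[OF xc(1)]]
      m_closed[OF m_closed[OF yc(1) g(1)] inv_closed[OF yc(1)]] xc yc
    by (simp_all add: s_def t_def inv_unitary_group)
  then have sc: "s \<in> carrier_mat n n" "t \<in> carrier_mat n n" by (auto simp: carrier_unitary_group_iff)
  have zT: "z \<in> proj_torus n \<E>" using T by (simp add: z_def s_def t_def)
  have zc: "z \<in> carrier_mat n n" using proj_torus_carrier[OF zT] by simp
  have sz: "s * z = t" unfolding z_def by (rule unitary_cancel_left(2)[OF sU(1) sc(2)])
  have "z = 1\<^sub>m n"
  proof (rule proj_system_ext[OF S zc])
    fix P assume P: "P \<in> \<E>"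
    note Pc = proj_systemD(2)[OF S P]
    obtain w where w: "z * P = w \<cdot>\<^sub>m P" using proj_torusE[OF zT P] .
    have "mtrace (g * P) = mtrace (t * P)"
      unfolding t_def by (rule mtrace_conj_mult[OF S y P gc, symmetric])
    also have "t * P = s * (z * P)" unfolding sz[symmetric] using sc zc Pc by simp
    also have "\<dots> = w \<cdot>\<^sub>m (s * P)" unfolding w using sc Pc by (simp add: mult_smult_distrib[of _ n n _ n])
    also have "mtrace \<dots> = w * mtrace (s * P)" using sc Pc by (simp add: mtrace_smult[of _ n])
    also have "mtrace (s * P) = mtrace (g * P)"
      unfolding s_def by (rule mtrace_conj_mult[OF S x P gc])
    finally have "w = 1" using mtrace_near_one_neq_0[OF S P gc g(2)] by simp
    then show "z * P = 1\<^sub>m n * P" using w Pc by (simp add: one_smult)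
  qed simp
  then have "s = t" using sz sc by simp
  then show ?thesis by (simp only: s_def t_def)
qed

text \<open>\<open>N\<close> records the loss so far: \<open>B^2 \<inter> H\<close> has at least
  \<open>|B| / N\<close> elements. Hypothesis and conclusion both refer to \<open>B^2\<close>, so
  that the step can be iterated at a fixed price \<open>Q\<close>.\<close>

lemma descent_step:
  fixes K N :: real
  assumes n: "n \<ge> 1" and K: "K \<ge> 1"
    and B: "finite B" "B \<subseteq> carrier (unitary_group n)" "set_inv\<^bsub>unitary_group n\<^esub> B = B" "B \<noteq> {}"
    and growth: "\<And>m. card (set_pow (unitary_group n) B (m + 3)) \<le> K ^ (12 * (m + 1)) * card B"
    and S: "proj_system n \<E>"
    and N: "card B \<le> N * card (set_pow (unitary_group n) B 2 \<inter> commutant n \<E>)" "N \<ge> 0"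
  defines "Q \<equiv> K ^ 216 * real ((16 * n + 1) ^ (2 * n\<^sup>2))"
  shows "card ((\<lambda>v. l_coset (unitary_group n) v (proj_torus n \<E>)) ` B) \<le> Q * N \<or>
    (\<exists>\<E>'. proj_system n \<E>' \<and> card \<E>' = Suc (card \<E>) \<and>
      card B \<le> (Q * N) * card (set_pow (unitary_group n) B 2 \<inter> commutant n \<E>'))"
proof -
  interpret group "unitary_group n" by (rule group_unitary_group)
  let ?G = "unitary_group n" and ?H = "commutant n \<E>" and ?T = "proj_torus n \<E>"
  let ?pow = "set_pow (unitary_group n) B"
  define c where "c = real ((16 * n + 1) ^ (2 * n\<^sup>2))"
  have c0: "c \<ge> 0" by (simp add: c_def)
  have powG: "?pow m \<subseteq> carrier ?G" for m by (rule set_pow_closed[OF B(2)])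
  have finpow: "finite (?pow m)" for m by (rule finite_set_pow[OF B(1)])
  have pow1: "?pow 1 = B" by (rule set_pow_1[OF B(2)])
  have pow_mult: "x * y \<in> ?pow m" if "x \<in> ?pow a" "y \<in> ?pow b" "a + b = m" for x y a b m
    using set_pow_mult_mem[OF B(2) that(1,2)] that(3) by simp
  have pow_adj: "mat_adjoint x \<in> ?pow m" if "x \<in> ?pow m" for x m
    using set_pow_inv_mem[OF B(2,3) that] powG[of m] that by (simp add: inv_unitary_group subset_iff)
  have cB: "0 < card B" using B by auto
  define D where "D = ?pow 2 \<inter> ?H"
  have D: "D \<subseteq> carrier ?G" "finite D" "D \<noteq> {}"
    using powG finpow N(1) cB by (auto simp: D_def)
  obtain d where d: "d \<in> D" "card D \<le> (16 * n + 1) ^ (2 * n\<^sup>2) * card {x \<in> D. frob (x - d) \<le> 1 / 5}"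
    using exists_dense_ball[OF D n] .
  have dU: "d \<in> carrier ?G" "d \<in> carrier_mat n n" using d D by (auto simp: carrier_unitary_group_iff)
  have inj_adj: "inj_on (\<lambda>x. mat_adjoint u * x) Y"
    if "u \<in> carrier ?G" "Y \<subseteq> carrier_mat n n" for u Y
  proof (rule inj_onI)
    fix x y assume xy: "x \<in> Y" "y \<in> Y" "mat_adjoint u * x = mat_adjoint u * y"
    then have c: "x \<in> carrier_mat n n" "y \<in> carrier_mat n n" using that(2) by auto
    show "x = y"
      using unitary_cancel_left(2)[OF that(1) c(1)] unitary_cancel_left(2)[OF that(1) c(2)]
      unfolding xy(3) by (rule trans[OF sym])
  qed
  \<comment> \<open>Translating the ball about \<open>d\<close> to 1 turns elements of
    \<open>B^2\<close> into elements of \<open>B^4\<close>.\<close>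
  define E where "E = (\<lambda>x. mat_adjoint d * x) ` {x \<in> D. frob (x - d) \<le> 1 / 5}"
  have Dc: "x \<in> carrier_mat n n" if "x \<in> D" for x
    using D that by (auto simp: carrier_unitary_group_iff)
  have "card E = card {x \<in> D. frob (x - d) \<le> 1 / 5}"
    unfolding E_def using dU Dc by (intro card_image inj_adj) auto
  then have cD: "card D \<le> c * card E"
    using d(2) unfolding c_def by (metis of_nat_le_iff of_nat_mult)
  have "card B \<le> N * (c * card E)"
    using N(1) mult_left_mono[OF cD N(2)] by (simp add: D_def)
  then have BE: "card B \<le> N * c * card E" by (simp add: mult.assoc)
  have E: "e \<in> ?pow 4" "e \<in> ?H" "frob (e - 1\<^sub>m n) \<le> 1 / 5" if "e \<in> E" for e
  proof -
    obtain x where x: "x \<in> D" "frob (x - d) \<le> 1 / 5" "e = mat_adjoint d * x"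
      using \<open>e \<in> E\<close> unfolding E_def by blast
    show "e \<in> ?pow 4" unfolding x(3) using x(1) d(1) by (intro pow_mult[of _ 2 _ 2] pow_adj) (auto simp: D_def)
    show "e \<in> ?H" unfolding x(3) using x(1) d(1) by (auto simp: D_def intro!: commutant_mult[OF S] commutant_adjoint[OF S])
    show "frob (e - 1\<^sub>m n) \<le> 1 / 5"
      unfolding x(3) using frob_adjoint_mult_minus_one[OF dU(1) Dc[OF x(1)]] x(2) by simp
  qed
  have finE: "finite E" using D by (simp add: E_def)
  have cE: "0 < card E"
  proof (rule ccontr)
    assume "\<not> 0 < card E"
    then have "card E = 0" by simp
    with BE cB show False by simp
  qed
  then have Ene: "E \<noteq> {}" by auto
  have K_le: "K ^ a \<le> K ^ b" if "a \<le> b" for a b :: nat using that K by (rule power_increasing)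
  show ?thesis
  proof (cases "E \<subseteq> ?T")
    \<comment> \<open>The number of cosets times \<open>|E|\<close> is at most \<open>|B^5|\<close>,
      and \<open>growth\<close> at \<open>m = 2\<close> gives \<open>K^36\<close>. The exponent is
      enlarged to 216 so that both alternatives share \<open>Q\<close>.\<close>
    case True
    have "B <#>\<^bsub>?G\<^esub> E \<subseteq> ?pow 1 <#>\<^bsub>?G\<^esub> ?pow 4"
      unfolding pow1 using E(1) by (intro mono_set_mult) auto
    also have "\<dots> = ?pow (1 + 4)" by (rule set_pow_add[OF B(2), symmetric])
    finally have "card (B <#>\<^bsub>?G\<^esub> E) \<le> card (?pow 5)"
      using finpow[of 5] by (intro card_mono) auto
    then have "card ((\<lambda>v. l_coset ?G v ?T) ` B) * card E \<le> card (?pow 5)"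
      using card_cosets_mult_le[OF subgroup_proj_torus[OF S] True finE B(1,2)] by linarith
    then have "real (card ((\<lambda>v. l_coset ?G v ?T) ` B)) * card E \<le> real (card (?pow 5))"
      by (metis of_nat_le_iff of_nat_mult)
    also have "\<dots> \<le> K ^ 36 * card B" using growth[of 2] by simp
    also have "\<dots> \<le> K ^ 36 * (N * c * card E)" using BE K by (intro mult_left_mono) auto
    also have "\<dots> \<le> K ^ 216 * (N * c * card E)"
      using K_le[of 36 216] N(2) c0 by (intro mult_right_mono) auto
    also have "\<dots> = (Q * N) * card E" by (simp add: Q_def c_def)
    finally have "card ((\<lambda>v. l_coset ?G v ?T) ` B) \<le> Q * N" using cE by simp
    then show ?thesis ..
  next
    case False
    \<comment> \<open>\<open>W\<close> contains an element of \<open>E\<close>, which is within 1/5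
      of 1; the minimiser \<open>g\<close> is then at least as close.\<close>
    define W where "W = ?pow 4 \<inter> ?H - ?T"
    have W: "finite W" "W \<noteq> {}" using finpow[of 4] E False by (auto simp: W_def)
    define g where "g = arg_min_on (\<lambda>x. frob (x - 1\<^sub>m n)) W"
    have gW: "g \<in> W" unfolding g_def by (rule arg_min_if_finite(1)[OF W])
    have gmin: "frob (g - 1\<^sub>m n) \<le> frob (x - 1\<^sub>m n)" if "x \<in> W" for x
      unfolding g_def by (rule arg_min_least[OF W that])
    have g: "g \<in> ?pow 4" "g \<in> ?H" "g \<notin> ?T" using gW by (auto simp: W_def)
    note gc = commutant_carrier[OF g(2)]
    obtain e where e: "e \<in> E" "e \<in> W" using False E by (auto simp: W_def)
    have g5: "frob (g - 1\<^sub>m n) \<le> 1 / 5" using gmin[OF e(2)] E(3)[OF e(1)] by linarith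
    have g0: "0 < frob (g - 1\<^sub>m n)"
    proof -
      have "1\<^sub>m n \<in> ?T" using subgroup.one_closed[OF subgroup_proj_torus[OF S]] by simp
      then have "g \<noteq> 1\<^sub>m n" using g(3) by auto
      then have "g - 1\<^sub>m n \<noteq> 0\<^sub>m n n" using minus_eq_zeroD[of g "1\<^sub>m n" n n] gc by auto
      then have "frob (g - 1\<^sub>m n) \<noteq> 0" using frob_eq_0_iff[of "g - 1\<^sub>m n" n n] by simp
      then show ?thesis using frob_nonneg[of "g - 1\<^sub>m n"] by linarith
    qed
    define f where "f x = x * g * mat_adjoint x" for x
    note Ec = commutant_carrier[OF E(2)]
    have fpow: "f x \<in> ?pow 12" if "x \<in> E" for x
      unfolding f_def using E(1)[OF that] g(1) by (intro pow_mult[of _ 8 _ 4] pow_mult[of _ 4 _ 4] pow_adj) auto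
    have fH: "f x \<in> ?H" if "x \<in> E" for x
      unfolding f_def using E(2)[OF that] g(2) by (intro commutant_mult[OF S] commutant_adjoint[OF S])
    note fc = commutant_carrier[OF fH]
    have fclose: "frob (f x - g) \<le> 2 / 5 * frob (g - 1\<^sub>m n)" if "x \<in> E" for x
    proof -
      have "frob (f x - g) \<le> 2 * frob (x - 1\<^sub>m n) * frob (g - 1\<^sub>m n)"
        unfolding f_def by (rule frob_conj_diff_le[OF Ec(1)[OF that] gc(1)])
      also have "\<dots> \<le> 2 * (1 / 5) * frob (g - 1\<^sub>m n)"
        using E(3)[OF that] by (intro mult_right_mono mult_left_mono) auto
      finally show ?thesis by simp
    qed
    \<comment> \<open>Each conjugate is within 2/5 of the distance from \<open>g\<close> to 1, so
      the quotient of two is within 4/5 of it. By minimality of \<open>g\<close> the quotient is not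
      in \<open>W\<close>, which for an element of \<open>B^4 \<inter> H\<close> means that it lies
      in \<open>T\<close>.\<close>
    have feq: "f x = f y" if xy: "x \<in> E" "y \<in> E" and u: "mat_adjoint (f x) * f y \<in> ?pow 4" for x y
    proof -
      have "frob (mat_adjoint (f x) * f y - 1\<^sub>m n) = frob (f y - f x)"
        by (rule frob_adjoint_mult_minus_one[OF fc(1)[OF xy(1)] fc(2)[OF xy(2)]])
      also have "f y - f x = (f y - g) - (f x - g)"
        using fc(2)[OF xy(1)] fc(2)[OF xy(2)] gc by (intro eq_matI) auto
      also have "frob \<dots> \<le> frob (f y - g) + frob (f x - g)"
        using fc(2)[OF xy(1)] fc(2)[OF xy(2)] gc by (intro frob_diff_le[of _ n n]) auto
      also have "\<dots> < frob (g - 1\<^sub>m n)" using fclose[OF xy(1)] fclose[OF xy(2)] g0 by linarith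
      finally have "mat_adjoint (f x) * f y \<notin> W" using gmin[of "mat_adjoint (f x) * f y"] by linarith
      moreover have "mat_adjoint (f x) * f y \<in> ?H"
        by (intro commutant_mult[OF S] commutant_adjoint[OF S] fH xy)
      ultimately have "mat_adjoint (f x) * f y \<in> ?T" using u by (simp add: W_def)
      then show ?thesis unfolding f_def
        using conj_eq_if_torus[OF S E(2)[OF xy(1)] E(2)[OF xy(2)] gc(1)] g5 by simp
    qed
    \<comment> \<open>The chosen translate determines the conjugate: if two conjugates are
      \<open>a * b\<close> and \<open>a * b'\<close> with \<open>b\<close>, \<open>b'\<close> in
      \<open>B^2\<close>, their quotient lies in \<open>B^4\<close> and \<open>feq\<close>
      applies.\<close>
    obtain F where F: "F \<subseteq> ?pow 12" "card F * card B \<le> card (?pow 12 <#>\<^bsub>?G\<^esub> B)"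
      "?pow 12 \<subseteq> F <#>\<^bsub>?G\<^esub> (B <#>\<^bsub>?G\<^esub> set_inv\<^bsub>?G\<^esub> B)"
      using ruzsa_covering[OF finpow[of 12] B(1) powG[of 12] B(2) B(4)] .
    have BB: "B <#>\<^bsub>?G\<^esub> set_inv\<^bsub>?G\<^esub> B = ?pow 2"
      using set_pow_add[OF B(2), of 1 1] unfolding pow1 B(3) by (simp add: numeral_2_eq_2)
    have "card (f ` E) \<le> card F"
    proof -
      have "\<forall>t\<in>f ` E. \<exists>a b. a \<in> F \<and> b \<in> ?pow 2 \<and> t = a * b"
      proof
        fix t assume "t \<in> f ` E"
        then have "t \<in> F <#>\<^bsub>?G\<^esub> ?pow 2" using fpow F(3) unfolding BB by blast
        then show "\<exists>a b. a \<in> F \<and> b \<in> ?pow 2 \<and> t = a * b" unfolding set_mult_def by auto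
      qed
      then obtain a b where ab: "\<And>t. t \<in> f ` E \<Longrightarrow> a t \<in> F \<and> b t \<in> ?pow 2 \<and> t = a t * b t"
        by metis
      have "inj_on a (f ` E)"
      proof (rule inj_onI)
        fix s t assume st: "s \<in> f ` E" "t \<in> f ` E" "a s = a t"
        then obtain x y where xy: "x \<in> E" "y \<in> E" "s = f x" "t = f y" by blast
        have s: "a s \<in> carrier ?G" "b s \<in> ?pow 2" "s = a s * b s"
          and t: "b t \<in> ?pow 2" "t = a s * b t"
          using ab[OF st(1)] ab[OF st(2)] F(1) powG[of 12] st(3) by auto
        have c: "a s \<in> carrier_mat n n" "b s \<in> carrier_mat n n" "b t \<in> carrier_mat n n"
          using s(1,2) t(1) powG[of 2] unfolding carrier_unitary_group_iff subset_iff by blast+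
        have "mat_adjoint s * t = mat_adjoint (a s * b s) * (a s * b t)" using s(3) t(2) by simp
        also have "\<dots> = mat_adjoint (b s) * (mat_adjoint (a s) * (a s * b t))"
          using c by (simp add: mat_adjoint_mult[of _ n n _ n] assoc_mult_mat[of _ n n _ n _ n])
        also have "\<dots> = mat_adjoint (b s) * b t" using unitary_cancel_left(1)[OF s(1) c(3)] by simp
        finally have "mat_adjoint s * t = mat_adjoint (b s) * b t" .
        moreover have "mat_adjoint (b s) * b t \<in> ?pow 4"
          using s(2) t(1) by (intro pow_mult[of _ 2 _ 2] pow_adj) auto
        ultimately show "s = t" using feq[OF xy(1,2)] xy(3,4) by simp
      qed
      then show ?thesis
        using ab finite_subset[OF F(1) finpow] by (intro card_inj_on_le[of a]) auto
    qed
    \<comment> \<open>\<open>growth\<close> at \<open>m = 10\<close> bounds \<open>B^13\<close>, and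
      \<open>12 * 11 = 132\<close>.\<close>
    moreover have "card F \<le> K ^ 132"
    proof -
      have "?pow 12 <#>\<^bsub>?G\<^esub> B = ?pow 13"
        using set_pow_add[OF B(2), of 12 1] unfolding pow1 by simp
      then have "real (card F) * card B \<le> card (?pow 13)"
        using F(2) by (metis of_nat_le_iff of_nat_mult)
      also have "\<dots> \<le> K ^ 132 * card B" using growth[of 10] by simp
      finally show ?thesis using cB by simp
    qed
    ultimately have cfE: "card (f ` E) \<le> K ^ 132" by linarith
    obtain e0 where e0: "e0 \<in> E" "card E \<le> card (f ` E) * card {x \<in> E. f x = f e0}"
      using exists_large_fibre[OF finE Ene, of f] by blast
    \<comment> \<open>Two elements conjugating \<open>g\<close> to the same matrix differ by an
      element of the centralizer of \<open>g\<close>. The translation by the inverse of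
      \<open>e0\<close> lands in \<open>B^8\<close>.\<close>
    define E' where "E' = (\<lambda>x. mat_adjoint e0 * x) ` {x \<in> E. f x = f e0}"
    have "card E' = card {x \<in> E. f x = f e0}"
      unfolding E'_def using Ec e0 by (intro card_image inj_adj) auto
    then have "real (card E) \<le> card (f ` E) * card E'"
      using e0(2) by (metis of_nat_le_iff of_nat_mult)
    also have "\<dots> \<le> K ^ 132 * card E'" unfolding of_nat_mult using cfE by (intro mult_right_mono) auto
    finally have EE': "card E \<le> K ^ 132 * card E'" .
    have cE': "0 < card E'"
    proof (rule ccontr)
      assume "\<not> 0 < card E'"
      then have "card E' = 0" by simp
      with EE' cE show False by simp
    qed
    have finE': "finite E'" using finE by (simp add: E'_def)
    obtain \<E>' where \<E>': "proj_system n \<E>'" "card \<E>' = Suc (card \<E>)"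
      "{x \<in> ?H. x * g = g * x} \<subseteq> commutant n \<E>'"
      using exists_proj_refinement[OF S g(2,3)] .
    have E': "y \<in> ?pow 8" "y \<in> commutant n \<E>'" if "y \<in> E'" for y
    proof -
      obtain x where x: "x \<in> E" "f x = f e0" "y = mat_adjoint e0 * x"
        using \<open>y \<in> E'\<close> unfolding E'_def by blast
      show "y \<in> ?pow 8"
        unfolding x(3) using E(1)[OF x(1)] E(1)[OF e0(1)] by (intro pow_mult[of _ 4 _ 4] pow_adj) auto
      have yH: "y \<in> ?H"
        unfolding x(3) by (intro commutant_mult[OF S] commutant_adjoint[OF S] E(2) x(1) e0(1))
      have xc: "x \<in> carrier ?G" "x \<in> carrier_mat n n" "e0 \<in> carrier ?G" "e0 \<in> carrier_mat n n"
        using Ec x(1) e0(1) by auto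
      then have axc: "mat_adjoint x \<in> carrier_mat n n" "mat_adjoint e0 \<in> carrier_mat n n"
        "mat_adjoint x * x = 1\<^sub>m n" by (auto simp: carrier_unitary_group_iff)
      have "f x * x = x * g"
        using xc axc gc by (simp add: f_def assoc_mult_mat[of _ n n _ n _ n])
      moreover have "f e0 * x = e0 * (g * (mat_adjoint e0 * x))"
        using xc axc gc by (simp add: f_def assoc_mult_mat[of _ n n _ n _ n])
      ultimately have xg: "x * g = e0 * (g * y)" using x(2,3) by simp
      have "y * g = mat_adjoint e0 * (x * g)"
        unfolding x(3) using xc axc gc by (simp add: assoc_mult_mat[of _ n n _ n _ n])
      also have "\<dots> = g * y"
        unfolding xg using unitary_cancel_left(1)[OF xc(3), of "g * y"] gc commutant_carrier[OF yH] by simp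
      finally show "y \<in> commutant n \<E>'" using \<E>'(3) yH by blast
    qed
    \<comment> \<open>Return from \<open>B^8\<close> to \<open>B^2\<close>: the coset count
      \<open>?cc\<close> is at most \<open>K^84 |B| / |E'|\<close>, by \<open>growth\<close> at
      \<open>m = 6\<close> for \<open>B^9\<close>, and at least \<open>|B| / |?P|\<close>. With the
      132 from the conjugates this makes 216.\<close>
    let ?P = "?pow 2 \<inter> commutant n \<E>'"
    let ?cc = "card ((\<lambda>v. l_coset ?G v (commutant n \<E>')) ` B)"
    have "B <#>\<^bsub>?G\<^esub> E' \<subseteq> ?pow 1 <#>\<^bsub>?G\<^esub> ?pow 8"
      unfolding pow1 using E'(1) by (intro mono_set_mult) auto
    also have "\<dots> = ?pow (1 + 8)" by (rule set_pow_add[OF B(2), symmetric])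
    finally have "card (B <#>\<^bsub>?G\<^esub> E') \<le> card (?pow 9)"
      using finpow[of 9] by (intro card_mono) auto
    then have "?cc * card E' \<le> card (?pow 9)"
      using card_cosets_mult_le[OF subgroup_commutant[OF \<E>'(1)] _ finE' B(1,2)] E'(2)
      by (meson le_trans subsetI)
    then have "real (?cc * card E') \<le> real (card (?pow 9))" by (simp only: of_nat_le_iff)
    also have "\<dots> \<le> K ^ 84 * card B" using growth[of 6] by simp
    finally have cc1: "real ?cc * card E' \<le> K ^ 84 * card B" by simp
    have cc2: "real (card B) \<le> real ?cc * card ?P"
      using card_le_cosets_mult[OF subgroup_commutant[OF \<E>'(1)] B] by (metis of_nat_le_iff of_nat_mult)
    have "real (card B) * card E' \<le> real ?cc * card ?P * card E'"
      using cc2 by (intro mult_right_mono) auto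
    also have "\<dots> = real ?cc * card E' * card ?P" by simp
    also have "\<dots> \<le> K ^ 84 * card B * card ?P" using cc1 by (intro mult_right_mono) auto
    finally have "card E' \<le> K ^ 84 * card ?P" using cB by (simp add: mult_ac)
    then have "K ^ 132 * card E' \<le> K ^ 132 * (K ^ 84 * card ?P)" using K by (intro mult_left_mono) auto
    with EE' have "card E \<le> K ^ 132 * (K ^ 84 * card ?P)" by linarith
    then have "card E \<le> K ^ 216 * card ?P" by (simp flip: power_add mult.assoc)
    then have "N * c * card E \<le> N * c * (K ^ 216 * card ?P)" using N(2) c0 by (intro mult_left_mono) auto
    with BE have "card B \<le> N * c * (K ^ 216 * card ?P)" by linarith
    also have "\<dots> = (Q * N) * card ?P" by (simp add: Q_def c_def)
    finally show ?thesis using \<E>' by blast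
  qed
qed

text \<open>At most \<open>n - card \<E>\<close> refinements remain, since each adds a projection,
  and the final stop costs one more factor; hence the exponent
  \<open>n + 1 - card \<E>\<close>.\<close>

lemma descent:
  fixes K N :: real
  assumes n: "n \<ge> 1" and K: "K \<ge> 1"
    and B: "finite B" "B \<subseteq> carrier (unitary_group n)" "set_inv\<^bsub>unitary_group n\<^esub> B = B" "B \<noteq> {}"
    and growth: "\<And>m. card (set_pow (unitary_group n) B (m + 3)) \<le> K ^ (12 * (m + 1)) * card B"
    and S: "proj_system n \<E>"
    and N: "card B \<le> N * card (set_pow (unitary_group n) B 2 \<inter> commutant n \<E>)" "N \<ge> 0"
  defines "Q \<equiv> K ^ 216 * real ((16 * n + 1) ^ (2 * n\<^sup>2))"
  shows "\<exists>\<E>'. proj_system n \<E>' \<and>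
    card ((\<lambda>v. l_coset (unitary_group n) v (proj_torus n \<E>')) ` B) \<le> Q ^ (n + 1 - card \<E>) * N"
  using S N
proof (induction "n - card \<E>" arbitrary: \<E> N rule: less_induct)
  case less
  have "1 \<le> K ^ 216" using K by (rule one_le_power)
  moreover have "1 \<le> real ((16 * n + 1) ^ (2 * n\<^sup>2))" by simp
  ultimately have "1 * 1 \<le> Q" unfolding Q_def by (intro mult_mono) auto
  then have Q: "1 \<le> Q" by simp
  have cn: "card \<E> \<le> n" by (rule card_proj_system_le[OF less.prems(1)])
  have QN: "0 \<le> Q * N" using Q less.prems(3) by simp
  consider (stop) "card ((\<lambda>v. l_coset (unitary_group n) v (proj_torus n \<E>)) ` B) \<le> Q * N"
    | (refine) \<E>' where "proj_system n \<E>'" "card \<E>' = Suc (card \<E>)"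
      "card B \<le> (Q * N) * card (set_pow (unitary_group n) B 2 \<inter> commutant n \<E>')"
    using descent_step[OF n K B growth less.prems] unfolding Q_def by blast
  then show ?case
  proof cases
    case stop
    \<comment> \<open>An early stop only wastes factors \<open>Q \<ge> 1\<close>;
      \<open>card \<E> \<le> n\<close> keeps the exponent at least 1.\<close>
    have "Q ^ 1 * N \<le> Q ^ (n + 1 - card \<E>) * N"
      using Q cn less.prems(3) by (intro mult_right_mono power_increasing) auto
    then show ?thesis using stop less.prems(1) by (intro exI[of _ \<E>]) auto
  next
    case refine
    have "card \<E>' \<le> n" by (rule card_proj_system_le[OF refine(1)])
    then have lt: "n - card \<E>' < n - card \<E>" and exp: "n + 1 - card \<E> = Suc (n + 1 - card \<E>')"
      using refine(2) by auto
    have "Q ^ (n + 1 - card \<E>') * (Q * N) = Q ^ (n + 1 - card \<E>) * N" unfolding exp by simp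
    then show ?thesis using less.hyps[OF lt refine(1,3) QN] by (simp only:)
  qed
qed

section \<open>Numerical bounds and conclusion\<close>

lemma proj_torus_one_dim: "proj_torus 1 {1\<^sub>m 1} = carrier (unitary_group 1)"
proof -
  have "M * 1\<^sub>m 1 = M $$ (0, 0) \<cdot>\<^sub>m 1\<^sub>m 1" if "M \<in> carrier (unitary_group 1)" for M
    using that by (intro eq_matI) (auto simp: carrier_unitary_group_iff)
  then show ?thesis by (auto simp: proj_torus_def)
qed

text \<open>For \<open>n \<ge> 2\<close> the constant \<open>2 ^ 5\<close> is absorbed into
  \<open>n ^ 5\<close>, so \<open>16 * n + 1 \<le> n ^ 6\<close>. At \<open>n = 1\<close> the right
  side is 1 and the inequality fails.\<close>

lemma grid_bound:
  assumes n: "n \<ge> 2"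
  shows "((16 * n + 1) ^ (2 * n\<^sup>2)) ^ n \<le> n ^ (12 * n ^ 3)"
proof -
  have "16 * n + 1 \<le> 2 ^ 5 * n" using n by simp
  also have "\<dots> \<le> n ^ 5 * n" using n by (intro mult_right_mono power_mono) auto
  also have "\<dots> = n ^ 6" by (simp add: eval_nat_numeral)
  finally have "((16 * n + 1) ^ (2 * n\<^sup>2)) ^ n \<le> ((n ^ 6) ^ (2 * n\<^sup>2)) ^ n"
    by (intro power_mono) auto
  also have "\<dots> = n ^ (12 * n ^ 3)"
    unfolding power_mult[symmetric] by (simp add: power2_eq_square power3_eq_cube mult.assoc)
  finally show ?thesis .
qed

text \<open>The descent starts from the single projection 1, whose commutant is the whole group, so
  \<open>N = 1\<close> and the exponent of \<open>Q\<close> is \<open>n\<close>. The translates in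
  \<open>F\<close> contribute a further \<open>K \<le> K ^ n\<close>, which turns 216 into
  217.\<close>

lemma coset_cover_unitary:
  fixes K :: real
  assumes n: "n \<ge> 2" and K: "K \<ge> 1" and A: "finite A" "A \<subseteq> carrier (unitary_group n)" "A \<noteq> {}"
    and AA: "card (A <#>\<^bsub>unitary_group n\<^esub> A) \<le> K * card A"
  shows "\<exists>\<E> V. proj_system n \<E> \<and> V \<subseteq> carrier (unitary_group n) \<and> finite V \<and> A \<subseteq> V \<and>
    card ((\<lambda>v. l_coset (unitary_group n) v (proj_torus n \<E>)) ` V) \<le> real n ^ (12 * n ^ 3) * K ^ (217 * n)"
proof -
  interpret group "unitary_group n" by (rule group_unitary_group)
  obtain B F where B: "finite B" "B \<subseteq> carrier (unitary_group n)" "\<one>\<^bsub>unitary_group n\<^esub> \<in> B"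
      "set_inv\<^bsub>unitary_group n\<^esub> B = B"
      "\<And>m. card (set_pow (unitary_group n) B (m + 3)) \<le> K ^ (12 * (m + 1)) * card B"
    and F: "F \<subseteq> carrier (unitary_group n)" "finite F" "card F \<le> K" "A \<subseteq> F <#>\<^bsub>unitary_group n\<^esub> B"
    using small_doubling_symmetric_set[OF A AA K] by blast
  have Bne: "B \<noteq> {}" using B(3) by auto
  have S1: "proj_system n {1\<^sub>m n}" using n by (intro proj_system_one) auto
  have "card B \<le> card (set_pow (unitary_group n) B 2)"
  proof -
    have "set_pow (unitary_group n) B 2 = B <#>\<^bsub>unitary_group n\<^esub> B"
      using set_pow_add[OF B(2), of 1 1] unfolding set_pow_1[OF B(2)] by (simp add: numeral_2_eq_2)
    then show ?thesis using card_le_card_set_mult_right[OF B(1,1,2,2) Bne] by simp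
  qed
  moreover have "set_pow (unitary_group n) B 2 \<inter> commutant n {1\<^sub>m n} = set_pow (unitary_group n) B 2"
    unfolding commutant_one using set_pow_closed[OF B(2)] by blast
  ultimately have N: "real (card B) \<le> 1 * real (card (set_pow (unitary_group n) B 2 \<inter> commutant n {1\<^sub>m n}))"
    by simp
  define c where "c = real ((16 * n + 1) ^ (2 * n\<^sup>2))"
  obtain \<E> where \<E>: "proj_system n \<E>"
    "card ((\<lambda>v. l_coset (unitary_group n) v (proj_torus n \<E>)) ` B) \<le> (K ^ 216 * c) ^ n"
    using descent[OF _ K B(1,2,4) Bne B(5) S1 N] n unfolding c_def by auto
  have TG: "proj_torus n \<E> \<subseteq> carrier (unitary_group n)" by (auto dest: proj_torus_carrier)
  let ?V = "F <#>\<^bsub>unitary_group n\<^esub> B"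
  have cn: "c ^ n \<le> real n ^ (12 * n ^ 3)"
    using grid_bound[OF n] unfolding c_def by (metis of_nat_le_iff of_nat_power)
  have "card ((\<lambda>v. l_coset (unitary_group n) v (proj_torus n \<E>)) ` ?V) \<le>
      card F * card ((\<lambda>v. l_coset (unitary_group n) v (proj_torus n \<E>)) ` B)"
    by (rule card_cosets_set_mult_le[OF TG F(2,1) B(1,2)])
  then have "real (card ((\<lambda>v. l_coset (unitary_group n) v (proj_torus n \<E>)) ` ?V)) \<le>
      real (card F) * card ((\<lambda>v. l_coset (unitary_group n) v (proj_torus n \<E>)) ` B)"
    by (metis of_nat_le_iff of_nat_mult)
  also have "\<dots> \<le> K * (K ^ 216 * c) ^ n" using F(3) \<E>(2) K by (intro mult_mono) auto
  also have "\<dots> \<le> K ^ n * (K ^ 216 * c) ^ n"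
    using K n power_increasing[of 1 n K] by (intro mult_right_mono) (auto simp: c_def)
  also have "\<dots> = c ^ n * K ^ (217 * n)"
  proof -
    have "217 * n = n + 216 * n" by simp
    then have "K ^ (217 * n) = K ^ n * (K ^ 216) ^ n" by (simp only: power_add power_mult)
    then show ?thesis by (simp add: power_mult_distrib)
  qed
  also have "\<dots> \<le> real n ^ (12 * n ^ 3) * K ^ (217 * n)"
    using cn K by (intro mult_right_mono) auto
  finally have "real (card ((\<lambda>v. l_coset (unitary_group n) v (proj_torus n \<E>)) ` ?V)) \<le>
    real n ^ (12 * n ^ 3) * K ^ (217 * n)" .
  moreover have "?V \<subseteq> carrier (unitary_group n)" "finite ?V"
    using F B by (auto intro!: finite_set_mult set_mult_closed del: subsetI)
  ultimately show ?thesis using \<E>(1) F(4) by blast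
qed

theorem mainTheorem4:
  shows "\<exists>C::real. C > 0 \<and>
    (\<forall>(n::nat) (K::real) (A::complex mat set).
       n \<ge> 1 \<longrightarrow> K \<ge> 1 \<longrightarrow>
       finite A \<longrightarrow> A \<subseteq> carrier (unitary_group n) \<longrightarrow>
       real (card (A <#>\<^bsub>unitary_group n\<^esub> A)) \<le> K * real (card A) \<longrightarrow>
       (\<exists>S. subgroup S (unitary_group n) \<and>
            comm_group (unitary_group n\<lparr>carrier := S\<rparr>) \<and>
            connectedin (mat_topology n) S \<and>
            (\<exists>\<C>. \<C> \<subseteq> lcosets\<^bsub>unitary_group n\<^esub> S \<and> finite \<C> \<and>
                 real (card \<C>) \<le> real n powr (C * real n ^ 3) * K powr (C * real n) \<and>
                 A \<subseteq> \<Union>\<C>)))"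
proof (intro exI[of _ "217::real"] conjI allI impI)
  fix n :: nat and K :: real and A :: "complex mat set"
  assume n: "n \<ge> 1" and K: "K \<ge> 1" and A: "finite A" "A \<subseteq> carrier (unitary_group n)"
    and AA: "real (card (A <#>\<^bsub>unitary_group n\<^esub> A)) \<le> K * real (card A)"
  interpret group "unitary_group n" by (rule group_unitary_group)
  have "\<exists>\<E> V. proj_system n \<E> \<and> V \<subseteq> carrier (unitary_group n) \<and> finite V \<and> A \<subseteq> V \<and>
    real (card ((\<lambda>v. l_coset (unitary_group n) v (proj_torus n \<E>)) ` V)) \<le>
      real n powr (217 * real n ^ 3) * K powr (217 * real n)"
  proof -
    have S1: "proj_system n {1\<^sub>m n}" using n by (rule proj_system_one)
    consider "A = {}" | "A \<noteq> {}" "n = 1" | "A \<noteq> {}" "n \<ge> 2" using n by linarith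
    then show ?thesis
    proof cases
      case 1
      then show ?thesis using S1 by (rule_tac exI[of _ "{1\<^sub>m n}"], rule_tac exI[of _ "{}"]) auto
    next
      case 2
      \<comment> \<open>For \<open>n = 1\<close> the bound allows no constant factor, but the torus
        is the whole group and a single coset covers \<open>A\<close>.\<close>
      have "subgroup (carrier (unitary_group n)) (unitary_group n)" by (rule subgroup_self)
      then have "l_coset (unitary_group n) v (proj_torus n {1\<^sub>m n}) = carrier (unitary_group n)" if "v \<in> A" for v
        using coset_join3[of v "carrier (unitary_group n)"] that A(2) 2(2) proj_torus_one_dim by auto
      then have "(\<lambda>v. l_coset (unitary_group n) v (proj_torus n {1\<^sub>m n})) ` A = {carrier (unitary_group n)}"
        using 2(1) by auto
      moreover have "1 \<le> K powr (217 * real n)" using K by (intro ge_one_powr_ge_zero) auto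
      ultimately show ?thesis using S1 A 2(2) by (rule_tac exI[of _ "{1\<^sub>m n}"], rule_tac exI[of _ A]) auto
    next
      case 3
      obtain \<E> V where V: "proj_system n \<E>" "V \<subseteq> carrier (unitary_group n)" "finite V" "A \<subseteq> V"
        "card ((\<lambda>v. l_coset (unitary_group n) v (proj_torus n \<E>)) ` V) \<le> real n ^ (12 * n ^ 3) * K ^ (217 * n)"
        using coset_cover_unitary[OF 3(2) K A 3(1) AA] by blast
      \<comment> \<open>One constant has to serve both exponents, so 12 is enlarged to 217.\<close>
      have "real n ^ (12 * n ^ 3) = real n powr real (12 * n ^ 3)"
        using n by (intro powr_realpow[symmetric]) auto
      also have "\<dots> \<le> real n powr (217 * real n ^ 3)" using n by (intro powr_mono) auto
      finally have "real n ^ (12 * n ^ 3) * K ^ (217 * n) \<le> real n powr (217 * real n ^ 3) * K ^ (217 * n)"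
        using K by (intro mult_right_mono) auto
      moreover have "K powr (217 * real n) = K ^ (217 * n)"
        using K powr_realpow[of K "217 * n"] by simp
      ultimately have "real (card ((\<lambda>v. l_coset (unitary_group n) v (proj_torus n \<E>)) ` V)) \<le>
        real n powr (217 * real n ^ 3) * K powr (217 * real n)"
        using V(5) by simp
      with V(1-4) show ?thesis by blast
    qed
  qed
  then obtain \<E> V where S: "proj_system n \<E>" and V: "V \<subseteq> carrier (unitary_group n)" "finite V" "A \<subseteq> V"
    "real (card ((\<lambda>v. l_coset (unitary_group n) v (proj_torus n \<E>)) ` V)) \<le>
      real n powr (217 * real n ^ 3) * K powr (217 * real n)" by blast
  let ?S = "proj_torus n \<E>" and ?C = "(\<lambda>v. l_coset (unitary_group n) v (proj_torus n \<E>)) ` V"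
  have "?C \<subseteq> lcosets\<^bsub>unitary_group n\<^esub> ?S" using V(1) by (auto simp: LCOSETS_def)
  moreover have "A \<subseteq> \<Union>?C" using lcos_self[OF _ subgroup_proj_torus[OF S]] V(1,3) by blast
  ultimately show "\<exists>S. subgroup S (unitary_group n) \<and>
      comm_group (unitary_group n\<lparr>carrier := S\<rparr>) \<and>
      connectedin (mat_topology n) S \<and>
      (\<exists>\<C>. \<C> \<subseteq> lcosets\<^bsub>unitary_group n\<^esub> S \<and> finite \<C> \<and>
        real (card \<C>) \<le> real n powr (217 * real n ^ 3) * K powr (217 * real n) \<and> A \<subseteq> \<Union>\<C>)"
    using subgroup_proj_torus[OF S] comm_group_proj_torus[OF S] connectedin_proj_torus[OF S] V(2,4)
    by (intro exI[of _ ?S] conjI exI[of _ ?C]) auto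
qed simp

end
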